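(* Let $n$ be a positive integer and let $k,m,a$ be complex numbers with $a\neq0$ such that all the functions below are defined. Then $$\sum _{p=1}^n 2^k \left(i 2^{-p}\right)^{1+k} e^{i 2^{-1-p} m} \Big(\Phi \left(e^{i 2^{1-p} m},-k,\tfrac{1}{4}-i 2^{-1+p} \log (a)\right)+e^{i 2^{-p} m}\, \Phi \left(e^{i 2^{1-p} m},-k,\tfrac{3}{4}-i 2^{-1+p} \log (a)\right)$$ $$-2 e^{i 2^{-1-p} m}\, \Phi \left(e^{i 2^{1-p} m},-k,\tfrac{1}{2} \left(1-i 2^p \log (a)\right)\right)\Big)$$ $$=-i 2^{-n} \left(2^n e^{\frac{1}{2} i (m+k \pi )}\, \Phi \left(e^{i m},-k,\tfrac{1}{2}-i \log (a)\right)-\left(i 2^{-n}\right)^k e^{i 2^{-1-n} m}\, \Phi \left(e^{i 2^{-n} m},-k,\tfrac{1}{2}-i 2^n \log (a)\right)\right).$$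
   Context: $\Phi(z,s,v)$ is the Hurwitz–Lerch zeta function: $\Phi(z,s,v)=\sum_{j=0}^{\infty}\frac{z^j}{(j+v)^s}$ for $v\notin\{0,-1,-2,\dots\}$ and $|z|<1$ (or $|z|=1$, $\operatorname{Re}s>1$), and by analytic continuation (principal branch, cut along $z\in[1,\infty)$) for other values; $\Phi(1,s,v)$ is the Hurwitz zeta function $\zeta(s,v)$. Logarithms and powers are principal values. *)

theory Defs
  imports "HOL-Complex_Analysis.Complex_Analysis"
begin

(* In this theory "powr" and "Ln" on complex numbers are the principal power and logarithm,
   with -pi < Im (Ln z) <= pi. *)

(* The Hurwitz zeta function zeta(s,v): the meromorphic continuation in s of its series, whose only
   singularity is the simple pole at s = 1.  The conditions determine f on -{1}, so for
   s \<noteq> 1 and v not in {0,-1,-2,...} the value does not depend on the choice; v may be any such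
   complex number, with principal powers in the series. *)
definition hurwitz_zeta :: "complex \<Rightarrow> complex \<Rightarrow> complex" where
  "hurwitz_zeta s v =
     (SOME f. f holomorphic_on - {1} \<and>
        (\<forall>s. Re s > 1 \<longrightarrow> (\<lambda>j. 1 / (of_nat j + v) powr s) sums f s)) s"

(* The continuation in z of the Hurwitz-Lerch series to the plane slit along [1,\<infinity>).  The slit
   plane is connected, so again f is determined there. *)
definition lerch_branch :: "complex \<Rightarrow> complex \<Rightarrow> complex \<Rightarrow> complex" where
  "lerch_branch s v =
     (SOME f. f holomorphic_on - (complex_of_real ` {1..}) \<and>
        (\<forall>z. norm z < 1 \<longrightarrow> (\<lambda>j. z ^ j / (of_nat j + v) powr s) sums f z))"

(* The Hurwitz-Lerch zeta function Phi(z,s,v).  For norm z = 1 and Re s > 1 the series still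
   converges and has this value: by Abel's theorem if z \<noteq> 1, and by the definition of
   hurwitz_zeta if z = 1.
   On the open cut z > 1 the function is continuous from below, the convention usual for the
   polylogarithm; there is no jump at all if s is in {0,-1,-2,...}, when Phi is rational in z. *)
definition hurwitz_lerch :: "complex \<Rightarrow> complex \<Rightarrow> complex \<Rightarrow> complex" where
  "hurwitz_lerch z s v =
     (if z = 1 then hurwitz_zeta s v
      else if z \<in> complex_of_real ` {1<..} then Lim (at z within {w. Im w < 0}) (lerch_branch s v)
      else lerch_branch s v z)"

(* Phi(z,s,v) is undefined exactly when v is a non-positive integer or when z = s = 1,
   the pole of the Hurwitz zeta function. *)
definition hurwitz_lerch_defined :: "complex \<Rightarrow> complex \<Rightarrow> complex \<Rightarrow> bool" where
  "hurwitz_lerch_defined z s v \<longleftrightarrow> v \<notin> \<int>\<^sub>\<le>\<^sub>0 \<and> \<not> (z = 1 \<and> s = 1)"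

end

theory Submission
  imports Defs
begin

text \<open>
  The identity is a telescoping sum. With \<open>w\<^sub>p = exp (\<i> m / 2^p)\<close> and \<open>u\<^sub>p = 1/2 - \<i> 2^p log a\<close>, put
  \<open>A\<^sub>p = (\<i> / 2^p)^(k + 1) exp (\<i> m / 2^(p + 1)) \<Phi>(w\<^sub>p, - k, u\<^sub>p)\<close>. Then \<open>w\<^sub>p\<^sup>2 = w\<^sub>(p - 1)\<close>, the first two parameters in
  the \<open>p\<close>-th summand are \<open>u\<^sub>p/2\<close> and \<open>(u\<^sub>p + 1)/2\<close>, and the third is \<open>u\<^sub>(p - 1)\<close>. The duplication formula
  \<open>\<Phi>(w\<^sup>2,s,v/2) + w \<Phi>(w\<^sup>2,s,(v + 1)/2) = 2^s \<Phi>(w,s,v)\<close> turns the \<open>p\<close>-th summand into \<open>A\<^sub>p - A\<^sub>(p - 1)\<close>, and the right-hand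
  side is \<open>A\<^sub>n - A\<^sub>0\<close>.

  In the unit disc the duplication formula only sorts the terms of the series by parity. The work is to
  carry it to all \<open>w\<close>, which requires that the continuations exist in the first place.

  Off the cut \<open>[1,\<infinity>)\<close>, the continuation in \<open>z\<close> is the integral of \<open>t^(s - 1) exp (- v t) / (1 - z exp (- t))\<close> over
  \<open>t > 0\<close>, divided by \<open>\<Gamma>(s)\<close>, for \<open>Re s > 0\<close> and \<open>Re v > 0\<close> (\<open>lerch_integral\<close>). Rotating the ray of integration
  extends it across the cut from below. The operator \<open>v + z d/dz\<close> lowers \<open>s\<close> by one, and dropping the first term raises
  \<open>v\<close> by one; together they reach all \<open>s\<close> and \<open>v\<close> (\<open>lerch_continuation_lerch_branch\<close>).

  In \<open>s\<close>, both \<open>\<zeta>(s,v)\<close> and \<open>\<Phi>(- 1,s,v)\<close> are continued by expanding a power of \<open>x + 1\<close> in powers of \<open>x\<close> and summing over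
  \<open>x = v + j\<close>: this expresses the value at \<open>s\<close> by those at \<open>s + 1, s + 2, \<dots>\<close> and a convergent series of remainders.

  The duplication formula then holds by the identity theorem if \<open>w\<^sup>2\<close> is off the cut, by passing to the limit if
  \<open>w\<^sup>2 > 1\<close>, and by continuation in \<open>s\<close> if \<open>w\<^sup>2 = 1\<close>, where \<open>w = 1\<close> and \<open>w = - 1\<close> give formulas for the sum and the
  difference of two Hurwitz zeta functions (\<open>hurwitz_lerch_duplication\<close>).
\<close>

section \<open>Holomorphic parameter integrals and the Laplace transform of a power\<close>

text \<open>
  Differentiation under the integral sign. A bound on the integrand itself suffices: by Cauchy's
  inequality it also bounds the difference quotients in the parameter, so that dominated convergence
  applies to them.
\<close>
lemma holomorphic_on_lebesgue_integral:
  fixes k :: "'t \<Rightarrow> complex \<Rightarrow> complex"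
  assumes "open U"
    and hol: "\<And>t. k t holomorphic_on U"
    and meas: "\<And>w. w \<in> U \<Longrightarrow> (\<lambda>t. k t w) \<in> borel_measurable M"
    and bound: "\<And>t w. w \<in> U \<Longrightarrow> norm (k t w) \<le> b t"
    and b: "integrable M b"
  shows "(\<lambda>w. \<integral>t. k t w \<partial>M) holomorphic_on U"
proof -
  have int: "integrable M (\<lambda>t. k t w)" if "w \<in> U" for w
    by (rule Bochner_Integration.integrable_bound[OF b meas[OF that]])
       (use bound[OF that] in \<open>auto intro!: AE_I2 intro: order_trans[OF _ abs_ge_self]\<close>)
  have "\<exists>D. ((\<lambda>w. \<integral>t. k t w \<partial>M) has_field_derivative D) (at w)" if w: "w \<in> U" for w
  proof -
    obtain r where r: "r > 0" "cball w r \<subseteq> U"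
      using \<open>open U\<close> w open_contains_cball by blast
    define S where "S = ball (0::complex) (r / 2)"
    have S: "w + h \<in> U" if "h \<in> S" for h
      using that r by (auto simp: S_def dist_norm subset_iff)
    have dk: "(k t has_field_derivative deriv (k t) x) (at x)" if "x \<in> U" for t x
      using hol[of t] \<open>open U\<close> that holomorphic_derivI by blast
    have dbound: "norm (deriv (k t) x) \<le> b t / (r / 2)" if "x \<in> ball w (r/2)" for t x
    proof -
      have sub: "cball x (r / 2) \<subseteq> U"
      proof
        fix y assume "y \<in> cball x (r / 2)"
        with that have "dist w y \<le> r"
          using dist_triangle[of w y x] by simp
        with r show "y \<in> U" by auto
      qed
      have "norm ((deriv ^^ 1) (k t) x) \<le> fact 1 * b t / (r / 2) ^ 1"
      proof (rule Cauchy_inequality)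
        show "k t holomorphic_on ball x (r / 2)" "continuous_on (cball x (r / 2)) (k t)"
          using hol[of t] sub ball_subset_cball
          by (meson holomorphic_on_subset order_trans holomorphic_on_imp_continuous_on)+
        show "norm (k t y) \<le> b t" if "norm (x - y) = r / 2" for y
          using that sub by (intro bound) (auto simp: dist_norm)
      qed (use r in auto)
      then show ?thesis by simp
    qed
    have quot: "norm ((k t (w + h) - k t w) / h) \<le> b t / (r / 2)" if "h \<in> S" "h \<noteq> 0" for t h
    proof -
      have "norm (k t (w + h) - k t w) \<le> b t / (r / 2) * norm (w + h - w)"
      proof (rule field_differentiable_bound[OF convex_ball])
        fix z assume "z \<in> ball w (r / 2)"
        moreover have "ball w (r / 2) \<subseteq> U"
          using r by (auto simp: subset_iff)
        ultimately show "(k t has_field_derivative deriv (k t) z) (at z within ball w (r / 2))"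
          using dk has_field_derivative_at_within by blast
      next
        show "w + h \<in> ball w (r / 2)" "w \<in> ball w (r / 2)"
          using that r by (auto simp: S_def dist_norm)
      qed (rule dbound)
      then show ?thesis
        using that by (simp add: norm_divide field_simps)
    qed
    have "((\<lambda>h. ((\<integral>t. k t (w + h) \<partial>M) - (\<integral>t. k t w \<partial>M)) / h) \<longlongrightarrow> (\<integral>t. deriv (k t) w \<partial>M))
            (at 0 within S)"
      unfolding tendsto_at_iff_sequentially comp_def
    proof (intro allI impI)
      fix X :: "nat \<Rightarrow> complex"
      assume X: "\<forall>i. X i \<in> S - {0}" "X \<longlonglongrightarrow> 0"
      have lim: "(\<lambda>i. (k t (w + X i) - k t w) / X i) \<longlonglongrightarrow> deriv (k t) w" for t
      proof -
        have "((\<lambda>h. (k t (w + h) - k t w) / h) \<longlongrightarrow> deriv (k t) w) (at 0)"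
          using dk[OF w] by (simp add: DERIV_def)
        moreover have "filterlim X (at 0) sequentially"
          using X by (auto simp: filterlim_at)
        ultimately show ?thesis
          by (rule filterlim_compose)
      qed
      have "(\<lambda>i. \<integral>t. (k t (w + X i) - k t w) / X i \<partial>M) \<longlonglongrightarrow> (\<integral>t. deriv (k t) w \<partial>M)"
      proof (rule integral_dominated_convergence)
        show m: "(\<lambda>t. (k t (w + X i) - k t w) / X i) \<in> borel_measurable M" for i
          using meas[OF w] meas[OF S[of "X i"]] X by simp
        show "(\<lambda>t. deriv (k t) w) \<in> borel_measurable M"
          by (rule borel_measurable_LIMSEQ_metric[OF m lim])
        show "integrable M (\<lambda>t. b t / (r / 2))"
          using b by simp
      qed (use lim quot X in auto)
      moreover have "(\<integral>t. (k t (w + X i) - k t w) / X i \<partial>M) =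
          ((\<integral>t. k t (w + X i) \<partial>M) - (\<integral>t. k t w \<partial>M)) / X i" for i
        using int[OF w] int[OF S[of "X i"]] X by simp
      ultimately show "(\<lambda>i. ((\<integral>t. k t (w + X i) \<partial>M) - (\<integral>t. k t w \<partial>M)) / X i)
          \<longlonglongrightarrow> (\<integral>t. deriv (k t) w \<partial>M)"
        by (simp only:)
    qed
    moreover have "at 0 within S = at 0"
      using r by (intro at_within_open) (auto simp: S_def)
    ultimately show ?thesis
      unfolding DERIV_def by auto
  qed
  then show ?thesis
    using \<open>open U\<close> by (auto simp: holomorphic_on_open)
qed

text \<open>
  The identity theorem in the form that extends a formula from real to complex parameters.
\<close>
lemma Re_pos_eq_of_real_pos:
  fixes f g :: "complex \<Rightarrow> complex"
  assumes "f holomorphic_on {w. Re w > 0}" "g holomorphic_on {w. Re w > 0}"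
    and "\<And>x::real. x > 0 \<Longrightarrow> f (of_real x) = g (of_real x)" and "Re w > 0"
  shows "f w = g w"
proof -
  have "f w - g w = 0"
  proof (rule analytic_continuation[of "\<lambda>z. f z - g z" "{w. Re w > 0}" "of_real ` {0<..}" 1])
    show "(1::complex) islimpt of_real ` {0<..}"
      unfolding islimpt_approachable
    proof (intro allI impI)
      fix e :: real assume "e > 0"
      then show "\<exists>x'\<in>complex_of_real ` {0<..}. x' \<noteq> 1 \<and> dist x' 1 < e"
        by (intro bexI[of _ "of_real (1 + e / 2)"] imageI) (simp_all add: dist_norm)
    qed
    show "(\<lambda>z. f z - g z) holomorphic_on {w. Re w > 0}"
      by (intro holomorphic_intros assms)
    show "connected {w. Re w > 0}"
      by (intro convex_connected convex_halfspace_Re_gt)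
  qed (use assms in \<open>auto simp: open_halfspace_Re_gt\<close>)
  then show ?thesis by simp
qed

lemma integrable_powr_exp:
  assumes "\<sigma> > 0" "a > (0::real)"
  shows "integrable lborel (\<lambda>u. indicator {0<..} u * (u powr (\<sigma> - 1) * exp (- a * u)))"
proof -
  have "set_integrable lebesgue {0<..} (\<lambda>t. complex_of_real t powr (of_real \<sigma> - 1) / of_real (exp (a * t)))"
    using assms by (intro absolutely_integrable_Gamma_integral) auto
  then have "integrable lebesgue (\<lambda>t. norm (indicator {0<..} t *\<^sub>R
      (complex_of_real t powr (of_real \<sigma> - 1) / of_real (exp (a * t)))))"
    unfolding set_integrable_def by (rule integrable_norm)
  also have "(\<lambda>t. norm (indicator {0<..} t *\<^sub>R
      (complex_of_real t powr (of_real \<sigma> - 1) / of_real (exp (a * t))))) =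
      (\<lambda>u. indicator {0<..} u * (u powr (\<sigma> - 1) * exp (- a * u)))"
    by (auto simp: fun_eq_iff indicator_def norm_mult norm_powr_real_powr exp_minus divide_inverse norm_inverse)
  finally show ?thesis
    by (subst (asm) integrable_completion) auto
qed

lemma norm_indicator_powr_exp:
  "norm (indicator {0<..} u *\<^sub>R (of_real u powr (s - 1) * exp (- w * of_real u))) =
     indicator {0<..} u * (u powr (Re s - 1) * exp (- Re w * u))"
  by (auto simp: indicator_def norm_mult norm_powr_real_powr)

lemma measurable_powr_exp [measurable]:
  "(\<lambda>u::real. complex_of_real u powr s * exp (w * complex_of_real u)) \<in> borel_measurable borel"
  unfolding powr_def by measurable

lemma set_integrable_powr_exp:
  assumes "Re s > 0" "Re w > 0"
  shows "set_integrable lborel {0<..} (\<lambda>u. complex_of_real u powr (s - 1) * exp (- w * of_real u))"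
  unfolding set_integrable_def
proof (rule Bochner_Integration.integrable_bound[OF integrable_powr_exp[OF assms]])
  show "AE x in lborel. norm (indicator {0<..} x *\<^sub>R (complex_of_real x powr (s - 1) * exp (- w * of_real x)))
      \<le> norm (indicator {0<..} x * (x powr (Re s - 1) * exp (- Re w * x)))"
    unfolding norm_indicator_powr_exp by auto
qed measurable

text \<open>
  For real \<open>w > 0\<close> this is Euler's integral after the substitution \<open>u \<mapsto> w u\<close>. For complex \<open>w\<close>
  a substitution would rotate the ray of integration; analytic continuation in \<open>w\<close> avoids this.
\<close>
lemma laplace_transform_powr:
  assumes s: "Re s > 0" and "Re w > 0"
  shows "(LINT u:{0<..}|lborel. complex_of_real u powr (s - 1) * exp (- w * of_real u)) =
           Gamma s * w powr (- s)"
proof (rule Re_pos_eq_of_real_pos[where w = w])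
  define k where "k = (\<lambda>u w. indicator {0<..} u *\<^sub>R (complex_of_real u powr (s - 1) * exp (- w * of_real u)))"
  show "(\<lambda>w. LINT u:{0<..}|lborel. complex_of_real u powr (s - 1) * exp (- w * of_real u))
      holomorphic_on {w. Re w > 0}"
    unfolding holomorphic_on_def
  proof
    fix w assume w: "w \<in> {w. Re w > 0}"
    have "(\<lambda>w. \<integral>u. k u w \<partial>lborel) holomorphic_on {z. Re z > Re w / 2}"
    proof (rule holomorphic_on_lebesgue_integral)
      show "integrable lborel (\<lambda>u. indicator {0<..} u * (u powr (Re s - 1) * exp (- (Re w / 2) * u)))"
        using integrable_powr_exp[of "Re s" "Re w / 2"] s w by simp
      show "norm (k u z) \<le> indicator {0<..} u * (u powr (Re s - 1) * exp (- (Re w / 2) * u))"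
        if "z \<in> {z. Re z > Re w / 2}" for u z
        unfolding k_def norm_indicator_powr_exp using that
        by (auto simp: indicator_def intro!: mult_left_mono)
      show "(\<lambda>u. k u z) \<in> borel_measurable lborel" for z
        unfolding k_def by measurable
      show "k u holomorphic_on {z. Re w / 2 < Re z}" for u
        unfolding k_def by (auto simp: scaleR_conv_of_real intro!: holomorphic_intros)
    qed (rule open_halfspace_Re_gt)
    then have "(\<lambda>w. \<integral>u. k u w \<partial>lborel) field_differentiable at w"
      by (rule holomorphic_on_imp_differentiable_at[OF _ open_halfspace_Re_gt]) (use w in auto)
    then show "(\<lambda>w. LINT u:{0<..}|lborel. complex_of_real u powr (s - 1) * exp (- w * of_real u))
        field_differentiable at w within {w. Re w > 0}"
      unfolding set_lebesgue_integral_def k_def by (rule field_differentiable_at_within)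
  qed
  show "(\<lambda>w. Gamma s * w powr (- s)) holomorphic_on {w. Re w > 0}"
    by (auto intro!: holomorphic_intros elim!: nonpos_Reals_cases)
  show "(LINT u:{0<..}|lborel. complex_of_real u powr (s - 1) * exp (- of_real x * of_real u)) =
      Gamma s * of_real x powr (- s)" if x: "x > 0" for x :: real
  proof -
    define f where "f = (\<lambda>u. indicator {0<..} u *\<^sub>R (complex_of_real u powr (s - 1) * exp (- 1 * of_real u)))"
    have "(\<lambda>t. complex_of_real t powr (s - 1) / of_real (exp t)) = (\<lambda>u. of_real u powr (s - 1) * exp (- 1 * of_real u))"
      by (auto simp: fun_eq_iff exp_minus divide_inverse simp flip: exp_of_real)
    then have "Gamma s = integral {0<..} (\<lambda>u. complex_of_real u powr (s - 1) * exp (- 1 * of_real u))"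
      using Gamma_integral_complex'[OF s] by (simp add: integral_unique)
    also have "\<dots> = (LINT u:{0<..}|lborel. complex_of_real u powr (s - 1) * exp (- 1 * of_real u))"
      using set_borel_integral_eq_integral(2)[OF set_integrable_powr_exp[OF s, of 1]] by simp
    also have "\<dots> = (\<integral>u. f u \<partial>lborel)"
      by (simp add: f_def set_lebesgue_integral_def)
    also have "\<dots> = x *\<^sub>R (\<integral>u. f (0 + x * u) \<partial>lborel)"
      using lborel_integral_real_affine[of x f 0] x by simp
    also have "(\<lambda>u. f (0 + x * u)) = (\<lambda>u. of_real x powr (s - 1) * k u (of_real x))"
      using x by (auto simp: fun_eq_iff f_def k_def indicator_def zero_less_mult_iff powr_times_real_left)
    also have "x *\<^sub>R (\<integral>u. of_real x powr (s - 1) * k u (of_real x) \<partial>lborel) =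
        of_real x powr s * (\<integral>u. k u (of_real x) \<partial>lborel)"
      using x by (simp add: scaleR_conv_of_real powr_diff)
    finally have "Gamma s = of_real x powr s * (\<integral>u. k u (of_real x) \<partial>lborel)" .
    then show ?thesis
      using x by (simp add: k_def set_lebesgue_integral_def powr_minus field_simps)
  qed
qed fact

lemma powr_mult_Re_pos:
  assumes "Re x > 0" "Re y > 0"
  shows "(x * y) powr s = x powr s * y powr (s :: complex)"
proof -
  have "x \<noteq> 0" "y \<noteq> 0"
    using assms by auto
  moreover have "Ln (x * y) = Ln x + Ln y"
    using Re_Ln_pos_lt_imp[OF assms(1)] Re_Ln_pos_lt_imp[OF assms(2)] calculation
    by (intro Ln_times_simple) auto
  ultimately show ?thesis
    by (simp add: powr_def ring_distribs exp_add)
qed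

section \<open>Continuation of the Lerch series in its argument\<close>

text \<open>
  The classical integral for \<open>\<Phi>(z,s,v)\<close>, taken along the ray through \<open>\<omega>\<close> (the variable is \<open>t = \<omega> u\<close>).
  The integrand is singular exactly if \<open>z\<close> lies on the curve \<open>{exp (\<omega> u) | u \<ge> 0}\<close>: for \<open>\<omega> = 1\<close> this is the
  cut \<open>[1,\<infinity>)\<close>, and for \<open>\<omega> = 1 + \<i> \<epsilon>\<close> it is a spiral that starts at \<open>1\<close> into the upper half-plane. The second
  choice therefore continues \<open>\<Phi>\<close> across the cut from below.
\<close>
definition lerch_integral :: "complex \<Rightarrow> complex \<Rightarrow> complex \<Rightarrow> complex \<Rightarrow> complex" where
  "lerch_integral \<omega> s v z = \<omega> powr s / Gamma s *
     (LINT u:{0<..}|lborel. of_real u powr (s - 1) * exp (- (v * \<omega>) * of_real u) / (1 - z * exp (- \<omega> * of_real u)))"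

text \<open>
  On the ray the denominator at \<open>z0\<close> tends to \<open>1\<close> and has no zero, so it has a positive
  minimum there; moving \<open>z0\<close> by \<open>e\<close> changes it by at most \<open>e\<close> because \<open>exp (- \<omega> u)\<close> has norm at most \<open>1\<close>.
\<close>
lemma denominator_bounded_below:
  fixes \<omega> z0 :: complex
  assumes \<omega>: "Re \<omega> > 0" and z0: "\<And>u. u \<ge> 0 \<Longrightarrow> z0 \<noteq> exp (\<omega> * of_real u)"
  obtains e where "e > 0" "\<And>z u. z \<in> ball z0 e \<Longrightarrow> u \<ge> 0 \<Longrightarrow> norm (1 - z * exp (- \<omega> * of_real u)) \<ge> e"
proof -
  define d where "d = (\<lambda>u::real. norm (1 - z0 * exp (- \<omega> * of_real u)))"
  have cont: "continuous_on A d" for A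
    unfolding d_def by (intro continuous_intros)
  have pos: "d u > 0" if "u \<ge> 0" for u
    using z0[OF that] by (auto simp: d_def exp_minus field_simps)
  have "((\<lambda>u::real. norm (z0 * exp (- \<omega> * of_real u))) \<longlongrightarrow> norm z0 * 0) at_top"
    unfolding norm_mult norm_exp_eq_Re using \<omega>
    by (intro tendsto_intros filterlim_compose[OF exp_at_bot])
       (simp add: filterlim_uminus_at_bot filterlim_tendsto_pos_mult_at_top[OF tendsto_const] filterlim_ident)
  then have "eventually (\<lambda>u::real. norm (z0 * exp (- \<omega> * of_real u)) < 1 / 2) at_top"
    by (rule order_tendstoD) simp
  then obtain T where T: "\<And>u. u \<ge> T \<Longrightarrow> norm (z0 * exp (- \<omega> * of_real u)) < 1 / 2"
    by (auto simp: eventually_at_top_linorder)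
  have far: "d u \<ge> 1 / 2" if "u \<ge> T" for u
    using T[OF that] norm_triangle_ineq2[of 1 "z0 * exp (- \<omega> * of_real u)"] by (simp add: d_def)
  obtain u0 where u0: "u0 \<in> {0..max 0 T}" "\<And>u. u \<in> {0..max 0 T} \<Longrightarrow> d u0 \<le> d u"
    using continuous_attains_inf[of "{0..max 0 T}" d] cont by auto
  \<comment> \<open>half the minimum, so that a shift of \<open>z0\<close> by \<open>e\<close> leaves at least \<open>e\<close>\<close>
  define e where "e = min (1 / 2) (d u0) / 2"
  show ?thesis
  proof
    show "e > 0"
      using pos[of u0] u0 by (auto simp: e_def)
    fix z u assume z: "z \<in> ball z0 e" and u: "u \<ge> (0::real)"
    have "2 * e \<le> d u"
    proof (cases "u \<ge> T")
      case True
      then show ?thesis using far[OF True] by (simp add: e_def)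
    next
      case False
      then show ?thesis using u0(2)[of u] u by (simp add: e_def)
    qed
    also have "d u \<le> norm (1 - z * exp (- \<omega> * of_real u)) + norm ((z - z0) * exp (- \<omega> * of_real u))"
      unfolding d_def by (rule order_trans[OF _ norm_triangle_ineq]) (simp add: algebra_simps)
    also have "norm ((z - z0) * exp (- \<omega> * of_real u)) \<le> e * 1"
      unfolding norm_mult using z u \<omega>
      by (intro mult_mono) (auto simp: dist_norm norm_minus_commute intro: order.trans[OF norm_ge_zero less_imp_le])
    finally show "e \<le> norm (1 - z * exp (- \<omega> * of_real u))"
      by simp
  qed
qed

lemma lerch_integral_holomorphic_near:
  assumes s: "Re s > 0" and \<omega>: "Re \<omega> > 0" and v: "Re (v * \<omega>) > 0"
    and z0: "\<And>u. u \<ge> 0 \<Longrightarrow> z0 \<noteq> exp (\<omega> * of_real u)"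
  shows "\<exists>e>0. lerch_integral \<omega> s v holomorphic_on ball z0 e"
proof -
  obtain e where e: "e > 0"
    "\<And>z u. z \<in> ball z0 e \<Longrightarrow> u \<ge> 0 \<Longrightarrow> norm (1 - z * exp (- \<omega> * of_real u)) \<ge> e"
    using denominator_bounded_below[OF \<omega> z0] by blast
  define g where "g = (\<lambda>u. indicator {0<..} u *\<^sub>R (complex_of_real u powr (s - 1) * exp (- (v * \<omega>) * of_real u)))"
  have norm_g: "norm (g u) = indicator {0<..} u * (u powr (Re s - 1) * exp (- Re (v * \<omega>) * u))" for u
    unfolding g_def by (rule norm_indicator_powr_exp)
  have "(\<lambda>z. \<integral>u. g u / (1 - z * exp (- \<omega> * of_real u)) \<partial>lborel) holomorphic_on ball z0 e"
  proof (rule holomorphic_on_lebesgue_integral)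
    show "integrable lborel (\<lambda>u. norm (g u) / e)"
      using integrable_powr_exp[OF s v] by (simp add: norm_g)
    show "(\<lambda>u. g u / (1 - z * exp (- \<omega> * of_real u))) \<in> borel_measurable lborel" for z
      unfolding g_def by measurable
    show "norm (g u / (1 - z * exp (- \<omega> * of_real u))) \<le> norm (g u) / e" if "z \<in> ball z0 e" for u z
    proof (cases "u > 0")
      case True
      then show ?thesis
        using e(2)[OF that, of u] \<open>e > 0\<close>
        by (auto simp: norm_divide intro!: divide_left_mono mult_pos_pos)
    qed (auto simp: g_def)
    show "(\<lambda>z. g u / (1 - z * exp (- \<omega> * of_real u))) holomorphic_on ball z0 e" for u
    proof (cases "u > 0")
      case True
      show ?thesis
      proof (intro holomorphic_intros)
        fix z assume "z \<in> ball z0 e"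
        then show "1 - z * exp (- \<omega> * of_real u) \<noteq> 0"
          using e(2)[of z u] \<open>e > 0\<close> True by auto
      qed
    qed (auto simp: g_def)
  qed simp
  then have "lerch_integral \<omega> s v holomorphic_on ball z0 e"
    unfolding lerch_integral_def set_lebesgue_integral_def
    by (intro holomorphic_intros) (simp add: g_def scaleR_conv_of_real)
  with e(1) show ?thesis by blast
qed

text \<open>
  Expand the geometric series under the integral and integrate termwise. The \<open>j\<close>-th term is a Laplace
  transform at \<open>(j + v) \<omega>\<close>; since both factors lie in the right half-plane, their principal powers
  multiply, and the powers of \<open>\<omega>\<close> cancel.
\<close>
lemma lerch_integral_sums:
  assumes s: "Re s > 0" and \<omega>: "Re \<omega> > 0" and v: "Re v > 0" and v\<omega>: "Re (v * \<omega>) > 0"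
    and z: "norm z < 1"
  shows "(\<lambda>j. z ^ j / (of_nat j + v) powr s) sums lerch_integral \<omega> s v z"
proof -
  define g where "g = (\<lambda>u. indicator {0<..} u *\<^sub>R (complex_of_real u powr (s - 1) * exp (- (v * \<omega>) * of_real u)))"
  define f where "f = (\<lambda>j u. g u * (z * exp (- \<omega> * complex_of_real u)) ^ j)"
  have norm_g: "norm (g u) = indicator {0<..} u * (u powr (Re s - 1) * exp (- Re (v * \<omega>) * u))" for u
    unfolding g_def by (rule norm_indicator_powr_exp)
  have int_g: "integrable lborel (\<lambda>u. norm (g u))"
    using integrable_powr_exp[OF s v\<omega>] by (simp only: norm_g)
  have q: "norm (z * exp (- \<omega> * complex_of_real u)) \<le> norm z" if "u > 0" for u
    using that \<omega> by (auto simp: norm_mult intro!: mult_left_le)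
  have f_le: "norm (f j u) \<le> norm (g u) * norm z ^ j" for j u
  proof (cases "u > 0")
    case True
    show ?thesis
      unfolding f_def norm_mult[of "g u"] norm_power using q[OF True]
      by (intro mult_left_mono power_mono) auto
  qed (auto simp: f_def g_def)
  have meas: "f j \<in> borel_measurable lborel" for j
    unfolding f_def g_def by measurable
  have int_f: "integrable lborel (f j)" for j
    by (rule Bochner_Integration.integrable_bound[OF integrable_mult_left[OF int_g, of "norm z ^ j"] meas])
       (use f_le in auto)
  have geo: "summable (\<lambda>j. norm z ^ j)"
    using z by (intro summable_geometric) simp
  have "(\<lambda>j. integral\<^sup>L lborel (f j)) sums (\<integral>u. (\<Sum>j. f j u) \<partial>lborel)"
  proof (rule sums_integral[OF int_f])
    show "AE u in lborel. summable (\<lambda>j. norm (f j u))"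
      using f_le by (intro AE_I2 summable_comparison_test'[OF summable_mult[OF geo]]) auto
    have "norm (\<integral>u. norm (f j u) \<partial>lborel) \<le> (\<integral>u. norm (g u) \<partial>lborel) * norm z ^ j" for j
      using integral_mono[OF integrable_norm[OF int_f[of j]] integrable_mult_left[OF int_g, of "norm z ^ j"] f_le]
      by simp
    then show "summable (\<lambda>j. \<integral>u. norm (f j u) \<partial>lborel)"
      by (intro summable_comparison_test'[OF summable_mult[OF geo]]) auto
  qed
  moreover have "integral\<^sup>L lborel (f j) = z ^ j * (Gamma s * (\<omega> powr (- s) * (of_nat j + v) powr (- s)))" for j
  proof -
    have pos: "Re ((of_nat j + v) * \<omega>) > 0"
      using v\<omega> \<omega> by (simp add: ring_distribs add_nonneg_pos)
    have "exp (- \<omega> * complex_of_real u) ^ j = exp (- (of_nat j * \<omega>) * of_real u)" for u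
      by (simp add: mult.assoc flip: exp_of_nat_mult)
    then have "f j = (\<lambda>u. z ^ j * (indicator {0<..} u *\<^sub>R
        (complex_of_real u powr (s - 1) * exp (- ((of_nat j + v) * \<omega>) * of_real u))))"
      by (auto simp: f_def g_def fun_eq_iff indicator_def power_mult_distrib ring_distribs mult_ac
          exp_add exp_diff exp_minus divide_inverse)
    then have "integral\<^sup>L lborel (f j) = z ^ j * (Gamma s * ((of_nat j + v) * \<omega>) powr (- s))"
      using laplace_transform_powr[OF s pos]
      by (simp only: set_lebesgue_integral_def integral_mult_right_zero)
    also have "((of_nat j + v) * \<omega>) powr (- s) = \<omega> powr (- s) * (of_nat j + v) powr (- s)"
      using v \<omega> by (subst powr_mult_Re_pos) auto
    finally show ?thesis .
  qed
  moreover have "(\<Sum>j. f j u) = g u / (1 - z * exp (- \<omega> * of_real u))" for u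
  proof (cases "u > 0")
    case True
    then have "norm (z * exp (- \<omega> * complex_of_real u)) < 1"
      using q[OF True] z by simp
    then show ?thesis
      unfolding f_def by (subst suminf_mult) (auto simp: suminf_geometric summable_geometric)
  qed (auto simp: f_def g_def)
  ultimately have "(\<lambda>j. z ^ j * (Gamma s * (\<omega> powr (- s) * (of_nat j + v) powr (- s)))) sums
      (\<integral>u. g u / (1 - z * exp (- \<omega> * of_real u)) \<partial>lborel)"
    by simp
  from sums_mult[OF this, of "\<omega> powr s / Gamma s"]
  have "(\<lambda>j. \<omega> powr s / Gamma s * (z ^ j * (Gamma s * (\<omega> powr (- s) * (of_nat j + v) powr (- s))))) sums
      lerch_integral \<omega> s v z"
    by (simp add: lerch_integral_def set_lebesgue_integral_def g_def scaleR_conv_of_real)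
  moreover have "\<omega> powr s / Gamma s * (z ^ j * (Gamma s * (\<omega> powr (- s) * (of_nat j + v) powr (- s)))) =
      z ^ j / (of_nat j + v) powr s" for j
  proof -
    have "Gamma s \<noteq> 0"
      using s by (auto simp: Gamma_eq_zero_iff elim!: nonpos_Ints_cases)
    moreover have "\<omega> powr s \<noteq> 0"
      using \<omega> by auto
    ultimately show ?thesis
      by (simp add: powr_minus divide_inverse mult_ac del: powr_eq_0_iff)
  qed
  ultimately show ?thesis
    by simp
qed

abbreviation slit_plane :: "complex set" where
  "slit_plane \<equiv> - (complex_of_real ` {1..})"

text \<open>
  The last clause says that \<open>f\<close> extends holomorphically to the points of the open cut from below.
  It gives the one-sided limits that define \<open>\<Phi>\<close> on the cut, and, unlike the mere existence of
  limits, it is inherited by derivatives.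
\<close>
definition lerch_continuation :: "complex \<Rightarrow> complex \<Rightarrow> (complex \<Rightarrow> complex) \<Rightarrow> bool" where
  "lerch_continuation s v f \<longleftrightarrow>
     f holomorphic_on slit_plane \<and>
     (\<forall>z. norm z < 1 \<longrightarrow> (\<lambda>j. z ^ j / (of_nat j + v) powr s) sums f z) \<and>
     (\<forall>x>1. \<exists>e>0. \<exists>g. g holomorphic_on ball (complex_of_real x) e \<and>
        (\<forall>z\<in>ball (complex_of_real x) e. Im z < 0 \<longrightarrow> f z = g z))"

lemma open_slit_plane: "open slit_plane"
proof -
  have "complex_of_real ` {1..} = \<real> \<inter> {z. Re z \<ge> 1}"
    by (auto elim!: Reals_cases)
  then show ?thesis
    by (auto intro!: open_Compl closed_Int closed_complex_Reals closed_halfspace_Re_ge)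
qed

lemma unit_disc_subset_slit_plane: "norm z < 1 \<Longrightarrow> z \<in> slit_plane"
  by auto

lemma Im_nonzero_in_slit_plane: "Im z \<noteq> 0 \<Longrightarrow> z \<in> slit_plane"
  by auto

lemma of_real_mult_in_slit_plane:
  assumes z: "z \<in> slit_plane" and t: "0 \<le> t" "t \<le> 1"
  shows "of_real t * z \<in> slit_plane"
proof
  assume "of_real t * z \<in> complex_of_real ` {1..}"
  then obtain x where x: "x \<ge> 1" "of_real t * z = complex_of_real x"
    by auto
  then have "t \<noteq> 0"
    by auto
  then have "z = complex_of_real (x / t)"
    using x(2) by (simp add: field_simps)
  moreover have "x / t \<ge> 1"
    using x t \<open>t \<noteq> 0\<close> by simp
  ultimately show False
    using z by (metis ComplD atLeast_iff imageI)
qed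

lemma connected_slit_plane: "connected slit_plane"
proof (rule starlike_imp_connected)
  have "closed_segment 0 z \<subseteq> slit_plane" if "z \<in> slit_plane" for z
  proof
    fix w assume "w \<in> closed_segment 0 z"
    then obtain t where t: "0 \<le> t" "t \<le> 1" and w: "w = of_real t * z"
      by (auto simp: closed_segment_def scaleR_conv_of_real)
    show "w \<in> slit_plane"
      unfolding w by (rule of_real_mult_in_slit_plane[OF that t])
  qed
  moreover have "0 \<in> slit_plane"
    by auto
  ultimately show "starlike slit_plane"
    unfolding starlike_def by blast
qed

lemma lerch_continuation_unique:
  assumes "f holomorphic_on slit_plane" "g holomorphic_on slit_plane"
    and "\<And>z. norm z < 1 \<Longrightarrow> (\<lambda>j. z ^ j / (of_nat j + v) powr s) sums f z"
    and "\<And>z. norm z < 1 \<Longrightarrow> (\<lambda>j. z ^ j / (of_nat j + v) powr s) sums g z"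
    and "z \<in> slit_plane"
  shows "f z = g z"
proof (rule analytic_continuation_open[of "ball 0 1" slit_plane f g])
  show "f w = g w" if "w \<in> ball 0 1" for w
    using that assms(3,4)[of w] by (auto intro: sums_unique2)
qed (use assms open_slit_plane connected_slit_plane in auto)

text \<open>
  As long as the spiral stays in the disc of radius \<open>2 x\<close>, its argument \<open>\<epsilon> u\<close> is below
  \<open>\<epsilon> ln (2 x) < \<pi>\<close>, so it has not yet left the upper half-plane.
\<close>
lemma exp_spiral_avoids_lower_disc:
  fixes \<epsilon> x u :: real
  assumes "x > 1" "\<epsilon> > 0" "\<epsilon> * ln (2 * x) < pi" "u \<ge> 0"
    and z: "norm z < 2 * x" "Im z < 0 \<or> z = of_real x"
  shows "z \<noteq> exp (Complex 1 \<epsilon> * of_real u)"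
proof
  assume eq: "z = exp (Complex 1 \<epsilon> * of_real u)"
  then have "exp u < 2 * x"
    using z by (simp add: norm_exp_eq_Re)
  then have "u < ln (2 * x)"
    using \<open>x > 1\<close> by (metis exp_less_cancel_iff exp_ln less_trans mult_pos_pos zero_less_numeral zero_less_one)
  then have "\<epsilon> * u < pi"
    using assms by (meson less_trans mult_strict_left_mono)
  moreover have "Im z = exp u * sin (\<epsilon> * u)"
    by (simp add: eq Im_exp)
  ultimately have "Im z \<ge> 0"
    using assms by (auto intro!: mult_nonneg_nonneg sin_ge_zero)
  with z have zx: "z = of_real x"
    by auto
  have "u = 0"
  proof (rule ccontr)
    assume "u \<noteq> 0"
    then have "sin (\<epsilon> * u) > 0"
      using assms \<open>\<epsilon> * u < pi\<close> by (intro sin_gt_zero) auto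
    then have "Im z > 0"
      using \<open>Im z = exp u * sin (\<epsilon> * u)\<close> by simp
    with zx show False by simp
  qed
  with eq zx \<open>x > 1\<close> show False
    by simp
qed

text \<open>
  The extension across the cut at \<open>x\<close> is the integral along a slightly rotated ray. Both integrals are
  holomorphic on the lower half of the disc of radius \<open>2 x\<close>, and they agree with the series near \<open>0\<close>.
\<close>
lemma lerch_continuation_integral:
  assumes s: "Re s > 0" and v: "Re v > 0"
  shows "lerch_continuation s v (lerch_integral 1 s v)"
  unfolding lerch_continuation_def
proof (intro conjI allI impI)
  have near: "\<exists>e>0. lerch_integral 1 s v holomorphic_on ball z e" if "z \<in> slit_plane" for z
  proof (rule lerch_integral_holomorphic_near[OF s])
    show "z \<noteq> exp (1 * complex_of_real u)" if "u \<ge> 0" for u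
    proof
      assume "z = exp (1 * complex_of_real u)"
      then have "z = of_real (exp u)"
        by (simp add: exp_of_real)
      then show False
        using \<open>z \<in> slit_plane\<close> that by auto
    qed
  qed (use v in auto)
  show hol: "lerch_integral 1 s v holomorphic_on slit_plane"
    unfolding holomorphic_on_def
  proof
    fix z assume "z \<in> slit_plane"
    then obtain e where "e > 0" "lerch_integral 1 s v holomorphic_on ball z e"
      using near by blast
    then have "lerch_integral 1 s v field_differentiable at z"
      by (auto intro!: holomorphic_on_imp_differentiable_at[where s = "ball z e"])
    then show "lerch_integral 1 s v field_differentiable at z within slit_plane"
      by (rule field_differentiable_at_within)
  qed
  show series: "(\<lambda>j. z ^ j / (of_nat j + v) powr s) sums lerch_integral 1 s v z" if "norm z < 1" for z
    using that s v by (intro lerch_integral_sums) auto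
  fix x :: real assume x: "x > 1"
  \<comment> \<open>the first bound keeps the spiral in the upper half-plane, the second keeps \<open>Re (v \<omega>)\<close> positive\<close>
  define \<epsilon> where "\<epsilon> = min (1 / ln (2 * x)) (Re v / (2 * (\<bar>Im v\<bar> + 1)))"
  have lnx: "ln (2 * x) > 0"
    using x by simp
  have \<epsilon>: "\<epsilon> > 0"
    using lnx v by (auto simp: \<epsilon>_def intro!: divide_pos_pos)
  have "\<epsilon> * ln (2 * x) \<le> 1 / ln (2 * x) * ln (2 * x)"
    using lnx by (intro mult_right_mono) (auto simp: \<epsilon>_def)
  then have \<epsilon>x: "\<epsilon> * ln (2 * x) < pi"
    using lnx pi_gt3 by simp
  have "\<epsilon> * Im v \<le> \<epsilon> * (\<bar>Im v\<bar> + 1)"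
    using \<epsilon> by (intro mult_left_mono) auto
  also have "\<dots> \<le> Re v / (2 * (\<bar>Im v\<bar> + 1)) * (\<bar>Im v\<bar> + 1)"
    by (intro mult_right_mono) (auto simp: \<epsilon>_def)
  also have "\<dots> = Re v / 2"
    by (simp add: field_simps)
  finally have \<epsilon>v: "Re (v * Complex 1 \<epsilon>) > 0"
    using v by (simp add: mult.commute)
  define g where "g = lerch_integral (Complex 1 \<epsilon>) s v"
  have near_g: "\<exists>e>0. g holomorphic_on ball z e"
    if "norm z < 2 * x" "Im z < 0 \<or> z = of_real x" for z
    unfolding g_def
    by (rule lerch_integral_holomorphic_near[OF s _ \<epsilon>v])
       (use exp_spiral_avoids_lower_disc[OF x \<epsilon> \<epsilon>x _ that] in auto)
  define W where "W = ball (0::complex) (2 * x) \<inter> {z. Im z < 0}"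
  have openW: "open W"
    unfolding W_def by (intro open_Int open_ball open_halfspace_Im_lt)
  have eq: "lerch_integral 1 s v z = g z" if "z \<in> W" for z
  proof (rule analytic_continuation_open[of "ball 0 1 \<inter> {z. Im z < 0}" W "lerch_integral 1 s v" g])
    show "open (ball (0::complex) 1 \<inter> {z. Im z < 0})"
      by (intro open_Int open_ball open_halfspace_Im_lt)
    have "- \<i> / 2 \<in> ball (0::complex) 1 \<inter> {z. Im z < 0}"
      by simp
    then show "ball (0::complex) 1 \<inter> {z. Im z < 0} \<noteq> {}"
      by blast
    show "connected W"
      unfolding W_def by (intro convex_connected convex_Int convex_ball convex_halfspace_Im_lt)
    show "ball 0 1 \<inter> {z. Im z < 0} \<subseteq> W"
      using x by (auto simp: W_def)
    have "W \<subseteq> slit_plane"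
      by (auto simp: W_def)
    then show "lerch_integral 1 s v holomorphic_on W"
      using hol holomorphic_on_subset by blast
    show "g holomorphic_on W"
      unfolding holomorphic_on_def
    proof
      fix z assume "z \<in> W"
      then obtain e where "e > 0" "g holomorphic_on ball z e"
        using near_g[of z] by (auto simp: W_def)
      then have "g field_differentiable at z"
        by (auto intro!: holomorphic_on_imp_differentiable_at[where s = "ball z e"])
      then show "g field_differentiable at z within W"
        by (rule field_differentiable_at_within)
    qed
    show "lerch_integral 1 s v z = g z" if "z \<in> ball 0 1 \<inter> {z. Im z < 0}" for z
    proof (rule sums_unique2)
      show "(\<lambda>j. z ^ j / (of_nat j + v) powr s) sums lerch_integral 1 s v z"
        using that by (intro series) auto
      show "(\<lambda>j. z ^ j / (of_nat j + v) powr s) sums g z"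
        unfolding g_def using that by (intro lerch_integral_sums s v \<epsilon>v) auto
    qed
  qed (use openW that in auto)
  obtain d where d: "d > 0" "g holomorphic_on ball (of_real x) d"
    using near_g[of "of_real x"] x by auto
  have "lerch_integral 1 s v z = g z" if "z \<in> ball (of_real x) (min d x)" "Im z < 0" for z
  proof (rule eq)
    have "norm z \<le> norm (z - of_real x) + norm (complex_of_real x)"
      using norm_triangle_sub[of z "of_real x"] by simp
    also have "\<dots> < 2 * x"
      using that x by (simp add: dist_norm norm_minus_commute)
    finally show "z \<in> W"
      using that by (simp add: W_def)
  qed
  moreover have "g holomorphic_on ball (of_real x) (min d x)"
    using d(2) by (rule holomorphic_on_subset) auto
  ultimately show "\<exists>e>0. \<exists>g. g holomorphic_on ball (complex_of_real x) e \<and>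
        (\<forall>z\<in>ball (complex_of_real x) e. Im z < 0 \<longrightarrow> lerch_integral 1 s v z = g z)"
    using d(1) x by (intro exI[of _ "min d x"]) auto
qed

text \<open>
  The Euler operator \<open>v + z d/dz\<close> multiplies the \<open>j\<close>-th term of the series by \<open>j + v\<close>, that is, it
  lowers \<open>s\<close> by one. This takes the continuation from the half-plane of convergence of the integral to all \<open>s\<close>.
\<close>
lemma lerch_continuation_lower_exponent:
  assumes f: "lerch_continuation s v f" and v: "v \<notin> \<int>\<^sub>\<le>\<^sub>0"
  shows "lerch_continuation (s - 1) v (\<lambda>z. v * f z + z * deriv f z)"
  unfolding lerch_continuation_def
proof (intro conjI allI impI)
  have hol: "f holomorphic_on slit_plane"
    and series: "\<And>z. norm z < 1 \<Longrightarrow> (\<lambda>j. z ^ j / (of_nat j + v) powr s) sums f z"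
    and below: "\<And>x. x > 1 \<Longrightarrow> \<exists>e>0. \<exists>g. g holomorphic_on ball (complex_of_real x) e \<and>
        (\<forall>z\<in>ball (complex_of_real x) e. Im z < 0 \<longrightarrow> f z = g z)"
    using f by (auto simp: lerch_continuation_def)
  show "(\<lambda>z. v * f z + z * deriv f z) holomorphic_on slit_plane"
    by (intro holomorphic_intros hol holomorphic_deriv open_slit_plane)
  show "(\<lambda>j. z ^ j / (of_nat j + v) powr (s - 1)) sums (v * f z + z * deriv f z)" if z: "norm z < 1" for z
  proof -
    define c where "c = (\<lambda>j. 1 / (of_nat j + v) powr s)"
    have c_sums: "(\<lambda>j. c j * z ^ j) sums f z" if "norm z < 1" for z
      using series[OF that] by (simp add: c_def mult.commute)
    have summ: "summable (\<lambda>j. c j * z ^ j)" if "norm z < 1" for z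
      using c_sums[OF that] by (rule sums_summable)
    have "((\<lambda>z. \<Sum>j. c j * z ^ j) has_field_derivative (\<Sum>j. diffs c j * z ^ j)) (at z)"
      by (rule termdiffs_strong'[OF summ z])
    then have "(f has_field_derivative (\<Sum>j. diffs c j * z ^ j)) (at z)"
      by (rule has_field_derivative_transform_within_open[of _ _ _ "ball 0 1"])
         (use z c_sums in \<open>auto simp: sums_iff\<close>)
    then have "deriv f z = (\<Sum>j. diffs c j * z ^ j)"
      by (rule DERIV_imp_deriv)
    moreover have "summable (\<lambda>j. diffs c j * z ^ j)"
      by (rule termdiff_converges[OF z summ])
    ultimately have "(\<lambda>j. diffs c j * z ^ j) sums deriv f z"
      by (simp add: sums_iff)
    then have "(\<lambda>j. z * (diffs c j * z ^ j)) sums (z * deriv f z)"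
      by (rule sums_mult)
    then have "(\<lambda>j. of_nat (Suc j) * c (Suc j) * z ^ Suc j) sums (z * deriv f z)"
      by (simp add: diffs_def mult_ac)
    then have "(\<lambda>j. of_nat j * c j * z ^ j) sums (z * deriv f z)"
      by (subst (asm) sums_Suc_iff) simp
    then have "(\<lambda>j. v * (c j * z ^ j) + of_nat j * c j * z ^ j) sums (v * f z + z * deriv f z)"
      by (intro sums_add sums_mult c_sums z)
    moreover have "v * (c j * z ^ j) + of_nat j * c j * z ^ j = z ^ j / (of_nat j + v) powr (s - 1)" for j
    proof -
      have "of_nat j + v \<noteq> 0"
      proof
        assume "of_nat j + v = 0"
        then have "v = - of_nat j"
          by (simp add: eq_neg_iff_add_eq_0 add.commute)
        with v show False by simp
      qed
      then show ?thesis
        by (simp add: c_def powr_diff field_simps)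
    qed
    ultimately show ?thesis
      by simp
  qed
  fix x :: real assume "x > 1"
  then obtain e g where e: "e > 0" and g: "g holomorphic_on ball (complex_of_real x) e"
    and fg: "\<And>z. z \<in> ball (complex_of_real x) e \<Longrightarrow> Im z < 0 \<Longrightarrow> f z = g z"
    using below by blast
  have "v * f z + z * deriv f z = v * g z + z * deriv g z"
    if z: "z \<in> ball (complex_of_real x) e" "Im z < 0" for z
  proof -
    have "eventually (\<lambda>z. z \<in> ball (complex_of_real x) e \<inter> {z. Im z < 0}) (nhds z)"
      using z by (intro eventually_nhds_in_open open_Int open_ball open_halfspace_Im_lt) auto
    then have "eventually (\<lambda>z. f z = g z) (nhds z)"
      by eventually_elim (use fg in auto)
    then have "deriv f z = deriv g z"
      by (intro deriv_cong_ev) auto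
    then show ?thesis
      using fg z by simp
  qed
  moreover have "(\<lambda>z. v * g z + z * deriv g z) holomorphic_on ball (complex_of_real x) e"
    by (intro holomorphic_intros g holomorphic_deriv) auto
  ultimately show "\<exists>e>0. \<exists>h. h holomorphic_on ball (complex_of_real x) e \<and>
        (\<forall>z\<in>ball (complex_of_real x) e. Im z < 0 \<longrightarrow> v * f z + z * deriv f z = h z)"
    using e by (intro exI[of _ e] conjI exI[of _ "\<lambda>z. v * g z + z * deriv g z"]) auto
qed

text \<open>
  Removing the first term of the series reduces the parameter \<open>v\<close> to \<open>v + 1\<close>, hence to the right half-plane.
\<close>
lemma lerch_continuation_shift:
  assumes f: "lerch_continuation s (v + 1) f"
  shows "lerch_continuation s v (\<lambda>z. 1 / v powr s + z * f z)"
  unfolding lerch_continuation_def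
proof (intro conjI allI impI)
  show "(\<lambda>z. 1 / v powr s + z * f z) holomorphic_on slit_plane"
    using f by (auto simp: lerch_continuation_def intro!: holomorphic_intros)
  show "(\<lambda>j. z ^ j / (of_nat j + v) powr s) sums (1 / v powr s + z * f z)" if "norm z < 1" for z
  proof -
    have "(\<lambda>j. z * (z ^ j / (of_nat j + (v + 1)) powr s)) sums (z * f z)"
      using f that by (intro sums_mult) (auto simp: lerch_continuation_def)
    then have "(\<lambda>j. z ^ Suc j / (of_nat (Suc j) + v) powr s) sums (z * f z)"
      by (simp add: add_ac)
    then show ?thesis
      by (subst (asm) sums_Suc_iff) (simp add: add.commute)
  qed
  fix x :: real assume "x > 1"
  then obtain e g where "e > 0" "g holomorphic_on ball (complex_of_real x) e"
    and "\<forall>z\<in>ball (complex_of_real x) e. Im z < 0 \<longrightarrow> f z = g z"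
    using f unfolding lerch_continuation_def by blast
  then show "\<exists>e>0. \<exists>h. h holomorphic_on ball (complex_of_real x) e \<and>
        (\<forall>z\<in>ball (complex_of_real x) e. Im z < 0 \<longrightarrow> 1 / v powr s + z * f z = h z)"
    by (intro exI[of _ e] conjI exI[of _ "\<lambda>z. 1 / v powr s + z * g z"]) (auto intro!: holomorphic_intros)
qed

lemma lerch_continuation_exists: "\<exists>f. lerch_continuation s v f"
proof -
  have right_half: "\<exists>f. lerch_continuation s v f" if v: "Re v > 0" for s v
  proof -
    have "\<exists>f. lerch_continuation s v f" if "Re s > - real n" for n s
      using that
    proof (induction n arbitrary: s)
      case 0
      then show ?case
        using lerch_continuation_integral[OF _ v] by auto
    next
      case (Suc n)
      then have "Re (s + 1) > - real n"
        by simp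
      then obtain f where f: "lerch_continuation (s + 1) v f"
        using Suc.IH[of "s + 1"] by auto
      have "v \<notin> \<int>\<^sub>\<le>\<^sub>0"
        using v by (auto elim!: nonpos_Ints_cases)
      from lerch_continuation_lower_exponent[OF f this] show ?case
        by auto
    qed
    moreover obtain n :: nat where "real n > - Re s"
      using reals_Archimedean2 by blast
    ultimately show ?thesis
      by (metis minus_less_iff)
  qed
  have "\<exists>f. lerch_continuation s v f" if "Re v > - real n" for n v
    using that
  proof (induction n arbitrary: v)
    case 0
    then show ?case
      using right_half by auto
  next
    case (Suc n)
    then have "Re (v + 1) > - real n"
      by simp
    then obtain f where "lerch_continuation s (v + 1) f"
      using Suc.IH[of "v + 1"] by auto
    then show ?case
      using lerch_continuation_shift by blast
  qed
  moreover obtain n :: nat where "real n > - Re v"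
    using reals_Archimedean2 by blast
  ultimately show ?thesis
    by (metis minus_less_iff)
qed

text \<open>
  The slit plane is connected, so the function that was chosen in the definition agrees with the
  one constructed here; in particular it too extends across the cut from below.
\<close>
lemma lerch_continuation_lerch_branch: "lerch_continuation s v (lerch_branch s v)"
proof -
  obtain f where f: "lerch_continuation s v f"
    using lerch_continuation_exists by blast
  then have "\<exists>f. f holomorphic_on slit_plane \<and>
      (\<forall>z. norm z < 1 \<longrightarrow> (\<lambda>j. z ^ j / (of_nat j + v) powr s) sums f z)"
    by (auto simp: lerch_continuation_def)
  from someI_ex[OF this]
  have branch: "lerch_branch s v holomorphic_on slit_plane"
      "\<And>z. norm z < 1 \<Longrightarrow> (\<lambda>j. z ^ j / (of_nat j + v) powr s) sums lerch_branch s v z"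
    unfolding lerch_branch_def by auto
  have "lerch_branch s v z = f z" if "Im z < 0" for z
    using branch f that
    by (intro lerch_continuation_unique[of _ _ v s]) (auto simp: lerch_continuation_def)
  with branch f show ?thesis
    unfolding lerch_continuation_def by metis
qed

lemmas lerch_branch_holomorphic = lerch_continuation_lerch_branch[unfolded lerch_continuation_def, THEN conjunct1]
lemmas lerch_branch_sums = lerch_continuation_lerch_branch
  [unfolded lerch_continuation_def, THEN conjunct2, THEN conjunct1, rule_format]

lemma lerch_branch_eqI:
  assumes "lerch_continuation s v f" "z \<in> slit_plane"
  shows "lerch_branch s v z = f z"
proof (rule lerch_continuation_unique[OF lerch_branch_holomorphic])
  show "f holomorphic_on slit_plane" "\<And>z. norm z < 1 \<Longrightarrow> (\<lambda>j. z ^ j / (of_nat j + v) powr s) sums f z"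
    using assms(1) by (auto simp: lerch_continuation_def)
qed (use assms lerch_branch_sums in auto)

lemma lerch_branch_tendsto_from_below:
  assumes "x > 1"
  shows "(lerch_branch s v \<longlongrightarrow> hurwitz_lerch (of_real x) s v) (at (of_real x) within {w. Im w < 0})"
proof -
  obtain e g where e: "e > 0" and g: "g holomorphic_on ball (complex_of_real x) e"
    and fg: "\<And>z. z \<in> ball (complex_of_real x) e \<Longrightarrow> Im z < 0 \<Longrightarrow> lerch_branch s v z = g z"
    using lerch_continuation_lerch_branch[of s v] assms unfolding lerch_continuation_def by blast
  have "isCont g (of_real x)"
    using holomorphic_on_imp_continuous_on[OF g] e by (simp add: continuous_on_interior)
  then have "(g \<longlongrightarrow> g (of_real x)) (at (of_real x) within {w. Im w < 0})"
    unfolding isCont_def by (rule tendsto_within_subset) auto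
  moreover have "eventually (\<lambda>z. g z = lerch_branch s v z) (at (of_real x) within {w. Im w < 0})"
    unfolding eventually_at using e fg by (intro exI[of _ e]) (auto simp: dist_commute)
  ultimately have lim: "(lerch_branch s v \<longlongrightarrow> g (of_real x)) (at (of_real x) within {w. Im w < 0})"
    by (rule Lim_transform_eventually)
  have "at (complex_of_real x) within {w. Im w < 0} \<noteq> bot"
    unfolding trivial_limit_within islimpt_approachable
  proof (simp, intro allI impI)
    fix d :: real assume "d > 0"
    then show "\<exists>y. Im y < 0 \<and> y \<noteq> complex_of_real x \<and> dist y (complex_of_real x) < d"
      by (intro exI[of _ "Complex x (- d / 2)"])
         (auto simp: dist_norm complex_eq_iff cmod_def)
  qed
  then have "Lim (at (of_real x) within {w. Im w < 0}) (lerch_branch s v) = g (of_real x)"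
    using lim by (intro tendsto_Lim)
  moreover have "hurwitz_lerch (of_real x) s v = Lim (at (of_real x) within {w. Im w < 0}) (lerch_branch s v)"
    using assms by (auto simp: hurwitz_lerch_def)
  ultimately show ?thesis
    using lim by simp
qed

section \<open>Dirichlet-type series and Taylor remainders of complex powers\<close>

text \<open>
  The argument of a complex number is at most \<open>\<pi>\<close>, so a complex power is its real counterpart up to a
  factor that is locally bounded in the exponent.
\<close>
lemma norm_powr_le: "norm (x powr a) \<le> norm x powr Re a * exp (pi * \<bar>Im a\<bar>)" for x a :: complex
proof -
  have "- Im a * Arg x \<le> \<bar>Im a\<bar> * \<bar>Arg x\<bar>"
    by (metis abs_ge_self abs_minus_cancel abs_mult mult_minus_left)
  also have "\<dots> \<le> \<bar>Im a\<bar> * pi"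
    using Arg_bounded[of x] by (intro mult_left_mono) auto
  finally show ?thesis
    unfolding norm_powr_complex by (intro mult_left_mono) (auto simp: mult.commute)
qed

text \<open>
  Series whose terms decay like \<open>j powr (- Re s - q)\<close> locally uniformly in \<open>s\<close> converge absolutely
  to a holomorphic function for \<open>Re s > 1 - q\<close>. The factor \<open>z ^ j\<close> serves both \<open>z = 1\<close> (the Hurwitz zeta
  function) and \<open>z = - 1\<close>.
\<close>
lemma
  fixes c :: "nat \<Rightarrow> complex \<Rightarrow> complex" and q :: real
  assumes hol: "\<And>j. c j holomorphic_on UNIV"
    and bound: "\<And>A. \<exists>K. \<forall>s j. norm s \<le> A \<and> Re s > 1 - q \<longrightarrow> norm (c j s) \<le> K * real (Suc j) powr (- Re s - q)"
  shows dirichlet_type_abs_summable: "Re s > 1 - q \<Longrightarrow> summable (\<lambda>j. norm (c j s))"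
    and dirichlet_type_holomorphic: "norm z \<le> 1 \<Longrightarrow> (\<lambda>s. \<Sum>j. z ^ j * c j s) holomorphic_on {s. Re s > 1 - q}"
proof -
  have majorant: "\<exists>K. \<forall>s j. norm s \<le> A \<and> Re s \<ge> \<sigma> \<longrightarrow> norm (c j s) \<le> K * real (Suc j) powr (- \<sigma> - q)"
    if \<sigma>: "\<sigma> > 1 - q" for A \<sigma>
  proof -
    obtain K where K: "\<And>s j. norm s \<le> A \<Longrightarrow> Re s > 1 - q \<Longrightarrow> norm (c j s) \<le> K * real (Suc j) powr (- Re s - q)"
      using bound by blast
    have "norm (c j s) \<le> \<bar>K\<bar> * real (Suc j) powr (- \<sigma> - q)" if "norm s \<le> A" "Re s \<ge> \<sigma>" for s j
    proof -
      have "norm (c j s) \<le> K * real (Suc j) powr (- Re s - q)"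
        using K that \<sigma> by auto
      also have "\<dots> \<le> \<bar>K\<bar> * real (Suc j) powr (- \<sigma> - q)"
        using that by (intro mult_mono powr_mono) auto
      finally show ?thesis .
    qed
    then show ?thesis by blast
  qed
  have summable_majorant: "summable (\<lambda>j. K * real (Suc j) powr (- \<sigma> - q))" if "\<sigma> > 1 - q" for K \<sigma>
    using that by (intro summable_mult) (subst summable_Suc_iff, subst summable_real_powr_iff, simp)
  show "summable (\<lambda>j. norm (c j s))" if s: "Re s > 1 - q"
  proof -
    obtain K where K: "\<And>j. norm (c j s) \<le> K * real (Suc j) powr (- Re s - q)"
      using majorant[OF s, of "norm s"] by auto
    then show ?thesis
      by (intro summable_comparison_test'[OF summable_majorant[OF s, of K]]) auto
  qed
  show "(\<lambda>s. \<Sum>j. z ^ j * c j s) holomorphic_on {s. Re s > 1 - q}" if z: "norm z \<le> 1"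
  proof (rule holomorphic_uniform_sequence)
    show "open {s. Re s > 1 - q}"
      by (rule open_halfspace_Re_gt)
    show "(\<lambda>s. \<Sum>j<n. z ^ j * c j s) holomorphic_on {s. Re s > 1 - q}" for n
      using hol by (intro holomorphic_intros) (auto intro: holomorphic_on_subset)
    fix s0 assume "s0 \<in> {s. Re s > 1 - q}"
    then have s0: "Re s0 > 1 - q" by simp
    define d where "d = (Re s0 - (1 - q)) / 2"
    define \<sigma> where "\<sigma> = Re s0 - d"
    have d: "d > 0" "\<sigma> > 1 - q"
      using s0 by (auto simp: d_def \<sigma>_def field_simps)
    obtain K where K: "\<And>s j. norm s \<le> norm s0 + d \<Longrightarrow> Re s \<ge> \<sigma> \<Longrightarrow>
        norm (c j s) \<le> K * real (Suc j) powr (- \<sigma> - q)"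
      using majorant[OF d(2)] by blast
    have ball: "norm s \<le> norm s0 + d" "Re s \<ge> \<sigma>" if "s \<in> cball s0 d" for s
    proof -
      have "norm (s - s0) \<le> d"
        using that by (simp add: dist_norm norm_minus_commute)
      then show "norm s \<le> norm s0 + d"
        using norm_triangle_sub[of s s0] by simp
      have "\<bar>Re (s - s0)\<bar> \<le> d"
        using \<open>norm (s - s0) \<le> d\<close> abs_Re_le_cmod order_trans by blast
      then show "Re s \<ge> \<sigma>"
        by (simp add: \<sigma>_def)
    qed
    have "uniform_limit (cball s0 d) (\<lambda>n s. \<Sum>j<n. z ^ j * c j s) (\<lambda>s. \<Sum>j. z ^ j * c j s) sequentially"
    proof (rule Weierstrass_m_test[OF _ summable_majorant[OF d(2)]])
      fix j s assume "s \<in> cball s0 d"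
      then have "norm (c j s) \<le> K * real (Suc j) powr (- \<sigma> - q)"
        using ball K by blast
      moreover have "norm (z ^ j * c j s) \<le> norm (c j s)"
        unfolding norm_mult norm_power using z by (intro mult_left_le_one_le power_le_one) auto
      ultimately show "norm (z ^ j * c j s) \<le> K * real (Suc j) powr (- \<sigma> - q)"
        by linarith
    qed
    then show "\<exists>d. 0 < d \<and> cball s0 d \<subseteq> {s. 1 - q < Re s} \<and>
        uniform_limit (cball s0 d) (\<lambda>n s. \<Sum>j<n. z ^ j * c j s) (\<lambda>s. \<Sum>j. z ^ j * c j s) sequentially"
      using d ball by (intro exI[of _ d]) force
  qed
qed

text \<open>
  Taylor's theorem for \<open>(1 + y) powr \<alpha>\<close>, with a constant that is uniform in bounded \<open>\<alpha>\<close>: on the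
  disc of radius \<open>1/2\<close> the norm of \<open>1 + y\<close> stays between \<open>1/2\<close> and \<open>2\<close>.
\<close>
lemma binomial_remainder_bound:
  "\<exists>K. \<forall>\<alpha> y :: complex. norm \<alpha> \<le> A \<and> norm y \<le> 1 / 2 \<longrightarrow>
     norm ((1 + y) powr \<alpha> - (\<Sum>r\<le>R. (\<alpha> gchoose r) * y ^ r)) \<le> K * norm y ^ Suc R"
  for A :: real
proof -
  define m where "m = A + real (Suc R)"
  define B where "B = m ^ Suc R * (2 powr m * exp (pi * m))"
  have main: "norm ((1 + y) powr \<alpha> - (\<Sum>r\<le>R. (\<alpha> gchoose r) * y ^ r)) \<le> B / fact R * norm y ^ Suc R"
    if \<alpha>: "norm \<alpha> \<le> A" and y: "norm y \<le> 1 / 2" for \<alpha> y :: complex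
  proof -
    define f where "f = (\<lambda>i y. (\<Prod>l=0..<i. \<alpha> - of_nat l) * (1 + y) powr (\<alpha> - of_nat i))"
    have Re: "Re (1 + y) > 0" if "norm y \<le> 1 / 2" for y
      using that abs_Re_le_cmod[of y] by simp
    have "norm (f 0 y - (\<Sum>i\<le>R. f i 0 * (y - 0) ^ i / fact i)) \<le> B * norm (y - 0) ^ Suc R / fact R"
    proof (rule complex_Taylor[of "cball 0 (1 / 2)"])
      fix i and x :: complex assume "x \<in> cball 0 (1 / 2)"
      then have "1 + x \<notin> \<real>\<^sub>\<le>\<^sub>0"
        using Re[of x] by (simp add: complex_nonpos_Reals_iff)
      then show "(f i has_field_derivative f (Suc i) x) (at x within cball 0 (1 / 2))"
        unfolding f_def by (auto intro!: derivative_eq_intros simp: algebra_simps)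
    next
      fix x :: complex assume "x \<in> cball 0 (1 / 2)"
      then have x: "norm x \<le> 1 / 2" by simp
      define \<beta> where "\<beta> = \<alpha> - of_nat (Suc R)"
      have \<beta>: "norm \<beta> \<le> m"
        unfolding \<beta>_def m_def using \<alpha> by (intro order_trans[OF norm_triangle_ineq4] add_mono) (auto simp del: of_nat_Suc)
      have lo: "1 / 2 \<le> norm (1 + x)" and hi: "norm (1 + x) \<le> 2"
        using x norm_triangle_ineq2[of 1 "-x"] norm_triangle_ineq[of 1 x] by auto
      have "norm (1 + x) powr Re \<beta> \<le> 2 powr \<bar>Re \<beta>\<bar>"
      proof (cases "Re \<beta> \<ge> 0")
        case True
        then show ?thesis using hi by (auto intro: powr_mono2)
      next
        case False
        then have "norm (1 + x) powr Re \<beta> \<le> (1 / 2) powr Re \<beta>"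
          using lo by (intro powr_mono2') auto
        also have "\<dots> = 2 powr \<bar>Re \<beta>\<bar>"
          using False by (simp add: powr_def ln_div)
        finally show ?thesis .
      qed
      also have "\<dots> \<le> 2 powr m"
        using \<beta> abs_Re_le_cmod[of \<beta>] by (intro powr_mono) auto
      finally have "norm (1 + x) powr Re \<beta> \<le> 2 powr m" .
      moreover have "exp (pi * \<bar>Im \<beta>\<bar>) \<le> exp (pi * m)"
        using \<beta> abs_Im_le_cmod[of \<beta>] by simp
      ultimately have "norm (1 + x) powr Re \<beta> * exp (pi * \<bar>Im \<beta>\<bar>) \<le> 2 powr m * exp (pi * m)"
        by (intro mult_mono) auto
      then have "norm ((1 + x) powr \<beta>) \<le> 2 powr m * exp (pi * m)"
        using norm_powr_le order_trans by blast
      moreover have "norm (\<Prod>l=0..<Suc R. \<alpha> - of_nat l) \<le> (\<Prod>l=0..<Suc R. m)"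
        unfolding prod_norm [symmetric] using \<alpha>
        by (intro prod_mono conjI norm_ge_zero)
           (auto simp: m_def intro!: order_trans[OF norm_triangle_ineq4] add_mono)
      ultimately show "norm (f (Suc R) x) \<le> B"
        unfolding f_def B_def \<beta>_def norm_mult
        using \<beta> by (intro mult_mono) (auto intro: order_trans[OF norm_ge_zero])
    qed (use y in auto)
    moreover have "(\<Sum>i\<le>R. f i 0 * (y - 0) ^ i / fact i) = (\<Sum>r\<le>R. (\<alpha> gchoose r) * y ^ r)"
      by (simp add: f_def gbinomial_prod_rev)
    ultimately show ?thesis
      by (simp add: f_def)
  qed
  show ?thesis
    by (intro exI[of _ "B / fact R"] allI impI main) auto
qed

text \<open>
  What is left of \<open>(x + 1) powr (- s)\<close> after its expansion in descending powers of \<open>x\<close> up to order \<open>R\<close>.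
\<close>
definition powr_remainder :: "nat \<Rightarrow> complex \<Rightarrow> complex \<Rightarrow> complex" where
  "powr_remainder R x s = (x + 1) powr (- s) - (\<Sum>r\<le>R. ((- s) gchoose r) * x powr (- s - of_nat r))"

text \<open>
  The remainder gains \<open>R + 1\<close> powers of \<open>j\<close> over the original term, so the series of remainders converges
  in a half-plane that grows with \<open>R\<close>. This gain drives both continuations in \<open>s\<close> below.
\<close>
lemma powr_remainder_bound:
  assumes v: "Re v \<ge> 2"
  shows "\<exists>K. \<forall>s j. norm s \<le> A \<and> Re s > 1 - real (Suc R) \<longrightarrow>
           norm (powr_remainder R (of_nat j + v) s) \<le> K * real (Suc j) powr (- Re s - real (Suc R))"
proof -
  obtain K where K: "\<And>\<alpha> y :: complex. norm \<alpha> \<le> A \<Longrightarrow> norm y \<le> 1 / 2 \<Longrightarrow>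
     norm ((1 + y) powr \<alpha> - (\<Sum>r\<le>R. (\<alpha> gchoose r) * y ^ r)) \<le> K * norm y ^ Suc R"
    using binomial_remainder_bound[of A R] by blast
  have main: "norm (powr_remainder R (of_nat j + v) s) \<le> (exp (pi * A) * \<bar>K\<bar>) * real (Suc j) powr (- Re s - real (Suc R))"
    if s: "norm s \<le> A" "Re s > 1 - real (Suc R)" for s j
  proof -
    define x where "x = of_nat j + v"
    have x: "Re x \<ge> real (Suc j)" "Re x \<ge> 2"
      using v by (auto simp: x_def)
    then have nx: "norm x \<ge> real (Suc j)" "norm x \<ge> 2" and x0: "x \<noteq> 0"
      using complex_Re_le_cmod[of x] by auto
    have Re_inv: "Re (1 + 1 / x) > 0"
      using x by (auto simp: Re_divide intro!: add_pos_nonneg)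
    have "powr_remainder R x s = x powr (- s) * ((1 + 1 / x) powr (- s) - (\<Sum>r\<le>R. ((- s) gchoose r) * (1 / x) ^ r))"
    proof -
      have "x + 1 = x * (1 + 1 / x)"
        using x0 by (simp add: field_simps)
      then have "(x + 1) powr (- s) = x powr (- s) * (1 + 1 / x) powr (- s)"
        using x Re_inv by (simp only: powr_mult_Re_pos)
      moreover have "x powr (- s - of_nat r) = x powr (- s) * (1 / x) ^ r" for r
        using x0 by (simp add: powr_diff power_one_over divide_inverse power_inverse)
      ultimately show ?thesis
        unfolding powr_remainder_def by (simp add: algebra_simps sum_distrib_left)
    qed
    also have "norm \<dots> \<le> (norm x powr (- Re s) * exp (pi * A)) * (\<bar>K\<bar> * norm (1 / x) ^ Suc R)"
      unfolding norm_mult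
    proof (intro mult_mono)
      have "exp (pi * \<bar>Im (- s)\<bar>) \<le> exp (pi * A)"
        using s(1) abs_Im_le_cmod[of s] by simp
      then have "norm x powr Re (- s) * exp (pi * \<bar>Im (- s)\<bar>) \<le> norm x powr Re (- s) * exp (pi * A)"
        by (intro mult_left_mono) auto
      then show "norm (x powr (- s)) \<le> norm x powr (- Re s) * exp (pi * A)"
        using norm_powr_le[of x "- s"] by (simp only: uminus_complex.sel)
      have "norm (1 / x) \<le> 1 / 2"
        using nx x0 by (auto simp: norm_divide divide_le_eq)
      then have "norm ((1 + 1 / x) powr (- s) - (\<Sum>r\<le>R. ((- s) gchoose r) * (1 / x) ^ r)) \<le> K * norm (1 / x) ^ Suc R"
        using K[of "- s" "1 / x"] s(1) by simp
      also have "\<dots> \<le> \<bar>K\<bar> * norm (1 / x) ^ Suc R"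
        by (intro mult_right_mono) auto
      finally show "norm ((1 + 1 / x) powr (- s) - (\<Sum>r\<le>R. ((- s) gchoose r) * (1 / x) ^ r)) \<le> \<bar>K\<bar> * norm (1 / x) ^ Suc R" .
    qed auto
    also have "\<dots> = (exp (pi * A) * \<bar>K\<bar>) * norm x powr (- Re s - real (Suc R))"
    proof -
      have "norm x powr (- Re s - real (Suc R)) = norm x powr (- Re s) / norm x ^ Suc R"
        using x0 powr_realpow[of "norm x" "Suc R"]
        by (simp only: powr_diff zero_less_norm_iff not_False_eq_True simp_thms)
      moreover have "norm (1 / x) ^ Suc R = 1 / norm x ^ Suc R"
        by (simp only: norm_divide norm_one power_one_over)
      ultimately show ?thesis
        by (simp only: times_divide_eq_right mult_1_right mult_ac)
    qed
    also have "\<dots> \<le> (exp (pi * A) * \<bar>K\<bar>) * real (Suc j) powr (- Re s - real (Suc R))"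
      using nx s(2) by (intro mult_left_mono powr_mono2') auto
    finally show ?thesis
      by (simp only: x_def)
  qed
  show ?thesis
    by (intro exI[of _ "exp (pi * A) * \<bar>K\<bar>"] allI impI main) auto
qed

lemma holomorphic_on_powr_exponent:
  "f holomorphic_on A \<Longrightarrow> (\<lambda>s. x powr f s) holomorphic_on A" for x :: complex
  by (cases "x = 0") (auto intro!: holomorphic_intros)

lemma powr_remainder_holomorphic: "powr_remainder R x holomorphic_on UNIV"
  unfolding powr_remainder_def gbinomial_prod_rev
  by (intro holomorphic_intros holomorphic_on_powr_exponent) auto

section \<open>Continuation of the Hurwitz zeta function\<close>

lemma zeta_terms_bound:
  assumes v: "Re v \<ge> 2"
  shows "\<exists>K. \<forall>s j. norm s \<le> A \<and> Re s > 1 - 0 \<longrightarrow>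
           norm ((of_nat j + v) powr (- s)) \<le> K * real (Suc j) powr (- Re s - 0)"
proof -
  have "norm ((of_nat j + v) powr (- s)) \<le> exp (pi * A) * real (Suc j) powr (- Re s - 0)"
    if s: "norm s \<le> A" "Re s > 1 - 0" for s j
  proof -
    have "norm ((of_nat j + v) powr (- s)) \<le> norm (of_nat j + v) powr (- Re s) * exp (pi * \<bar>Im s\<bar>)"
      using norm_powr_le[of "of_nat j + v" "- s"] by simp
    also have "\<dots> \<le> real (Suc j) powr (- Re s) * exp (pi * A)"
    proof (intro mult_mono powr_mono2')
      show "real (Suc j) \<le> norm (of_nat j + v)"
        using complex_Re_le_cmod[of "of_nat j + v"] v by simp
      show "exp (pi * \<bar>Im s\<bar>) \<le> exp (pi * A)"
        using s(1) abs_Im_le_cmod[of s] by simp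
    qed (use s in auto)
    finally show ?thesis
      by (simp add: mult.commute)
  qed
  then show ?thesis by blast
qed

lemma powr_holomorphic_exponent: "(\<lambda>s. x powr (- s)) holomorphic_on A" for x :: complex
  by (intro holomorphic_on_powr_exponent holomorphic_intros)

lemma zeta_series_abs_summable:
  assumes "Re s > 1"
  shows "summable (\<lambda>j. norm ((of_nat j + v) powr (- s)))"
proof -
  obtain n :: nat where n: "real n > 2 - Re v"
    using reals_Archimedean2 by blast
  have "summable (\<lambda>j. norm ((of_nat j + (of_nat n + v)) powr (- s)))"
    using n assms
    by (intro dirichlet_type_abs_summable[OF powr_holomorphic_exponent zeta_terms_bound]) auto
  then show ?thesis
    by (subst summable_iff_shift[of _ n, symmetric]) (simp add: add_ac)
qed

lemma zeta_series_summable: "Re s > 1 \<Longrightarrow> summable (\<lambda>j. (of_nat j + v) powr (- s))"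
  by (rule summable_norm_cancel[OF zeta_series_abs_summable])

lemma powr_remainder_series_holomorphic:
  assumes "Re v \<ge> 2" "norm z \<le> 1"
  shows "(\<lambda>s. \<Sum>j. z ^ j * powr_remainder R (of_nat j + v) s) holomorphic_on {s. Re s > - real R}"
  using dirichlet_type_holomorphic[OF powr_remainder_holomorphic powr_remainder_bound[OF assms(1)] assms(2), of R]
  by simp

lemma powr_remainder_abs_summable:
  assumes "Re v \<ge> 2" "Re s > - real R"
  shows "summable (\<lambda>j. norm (powr_remainder R (of_nat j + v) s))"
  using dirichlet_type_abs_summable[OF powr_remainder_holomorphic powr_remainder_bound[OF assms(1)], of R s] assms(2)
  by simp

text \<open>
  Sum the expansion of \<open>(x + 1) powr (1 - s)\<close> in powers of \<open>x\<close> over \<open>x = v, v + 1, \<dots>\<close>: the difference of the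
  leading terms telescopes to \<open>- v powr (1 - s)\<close>, and the others are values of the same series at
  \<open>s, s + 1, \<dots>\<close>. In terms of \<open>(s - 1) \<zeta>(s,v)\<close> the coefficients are polynomials in \<open>s\<close>: the factor
  \<open>1 - s - i\<close> of \<open>(1 - s) gchoose (i + 1)\<close> cancels the pole at \<open>s = 1 - i\<close>.
\<close>
lemma zeta_series_recurrence:
  fixes v :: complex
  defines "Y \<equiv> (\<lambda>s. (s - 1) * (\<Sum>j. (of_nat j + v) powr (- s)))"
  assumes v: "Re v \<ge> 2" and s: "Re s > 1"
  shows "Y s = (\<Sum>j. powr_remainder (Suc n) (of_nat j + v) (s - 1)) + v powr (1 - s) -
           (\<Sum>i<n. ((1 - s) gchoose Suc i) / of_nat (i + 2) * Y (s + of_nat (Suc i)))"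
proof -
  define x where "x = (\<lambda>j. of_nat j + v)"
  define Z where "Z = (\<lambda>s. \<Sum>j. x j powr (- s))"
  define b where "b = (\<lambda>i. ((1 - s) gchoose i) / of_nat (Suc i))"
  have b_Y: "((1 - s) gchoose Suc i) * Z (s + of_nat i) = - (b i * Y (s + of_nat i))" for i
  proof -
    have "of_nat (Suc i) * ((1 - s) gchoose Suc i) = ((1 - s) - of_nat i) * ((1 - s) gchoose i)"
      using gbinomial_absorb_comp[of "1 - s" i] gbinomial_absorption[of i "1 - s"] by (simp add: mult_ac)
    then have "(1 - s) gchoose Suc i = ((1 - s) - of_nat i) * b i"
      unfolding b_def by (simp add: field_simps del: of_nat_Suc)
    moreover have "Y (s + of_nat i) = (s + of_nat i - 1) * Z (s + of_nat i)"
      by (simp add: Y_def Z_def x_def)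
    ultimately show ?thesis
      by algebra
  qed
  have "(\<lambda>j. x j powr (1 - s)) \<longlonglongrightarrow> 0"
  proof -
    have lim: "(\<lambda>j. exp (pi * \<bar>Im s\<bar>) * real (Suc j) powr (- (Re s - 1))) \<longlonglongrightarrow> exp (pi * \<bar>Im s\<bar>) * 0"
      using s by (intro tendsto_intros tendsto_neg_powr filterlim_compose[OF filterlim_real_sequentially] filterlim_Suc) auto
    have le: "norm (x j powr (1 - s)) \<le> exp (pi * \<bar>Im s\<bar>) * real (Suc j) powr (- (Re s - 1))" for j
    proof -
      have "norm (x j powr (1 - s)) \<le> norm (x j) powr (1 - Re s) * exp (pi * \<bar>Im s\<bar>)"
        using norm_powr_le[of "x j" "1 - s"] by simp
      also have "norm (x j) powr (1 - Re s) \<le> real (Suc j) powr (1 - Re s)"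
        using complex_Re_le_cmod[of "x j"] v s by (intro powr_mono2') (auto simp: x_def)
      finally show ?thesis
        by (simp add: mult.commute)
    qed
    show ?thesis
      by (rule Lim_null_comparison[OF always_eventually[OF allI, OF le] lim[unfolded mult_zero_right]])
  qed
  then have "(\<lambda>j. x (Suc j) powr (1 - s) - x j powr (1 - s)) sums (0 - x 0 powr (1 - s))"
    by (rule telescope_sums)
  moreover have "(\<lambda>j. \<Sum>i\<le>n. ((1 - s) gchoose Suc i) * x j powr (- (s + of_nat i))) sums
      (\<Sum>i\<le>n. ((1 - s) gchoose Suc i) * Z (s + of_nat i))"
    unfolding Z_def x_def using s by (intro sums_sum sums_mult summable_sums zeta_series_summable) auto
  ultimately have "(\<lambda>j. (x (Suc j) powr (1 - s) - x j powr (1 - s)) -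
      (\<Sum>i\<le>n. ((1 - s) gchoose Suc i) * x j powr (- (s + of_nat i)))) sums
      ((0 - x 0 powr (1 - s)) - (\<Sum>i\<le>n. ((1 - s) gchoose Suc i) * Z (s + of_nat i)))"
    by (rule sums_diff)
  moreover have "(x (Suc j) powr (1 - s) - x j powr (1 - s)) -
      (\<Sum>i\<le>n. ((1 - s) gchoose Suc i) * x j powr (- (s + of_nat i))) = powr_remainder (Suc n) (x j) (s - 1)" for j
    unfolding powr_remainder_def sum.atMost_Suc_shift by (simp add: x_def algebra_simps)
  ultimately have "(\<Sum>j. powr_remainder (Suc n) (x j) (s - 1)) =
      - (v powr (1 - s)) + (\<Sum>i\<le>n. b i * Y (s + of_nat i))"
    by (simp add: sums_iff b_Y sum_negf x_def)
  also have "(\<Sum>i\<le>n. b i * Y (s + of_nat i)) = Y s + (\<Sum>i<n. b (Suc i) * Y (s + of_nat (Suc i)))"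
    by (subst sum.atMost_shift) (simp add: b_def)
  finally show ?thesis
    by (simp add: x_def b_def add.commute)
qed

text \<open>
  The recurrence expresses \<open>(s - 1) \<zeta>(s,v)\<close> by its values to the right, at \<open>s + 1, \<dots>, s + n\<close>, so each use
  moves the boundary of the domain by one to the left.
\<close>
lemma zeta_continuation_half_plane:
  assumes v: "Re v \<ge> 2"
  shows "\<exists>Y. Y holomorphic_on {s. Re s > 1 - real n} \<and>
           (\<forall>s. Re s > 1 \<longrightarrow> Y s = (s - 1) * (\<Sum>j. (of_nat j + v) powr (- s)))"
proof (induction n)
  case 0
  have "(\<lambda>s. \<Sum>j. 1 ^ j * (of_nat j + v) powr (- s)) holomorphic_on {s. Re s > 1 - 0}"
    by (rule dirichlet_type_holomorphic[OF powr_holomorphic_exponent zeta_terms_bound[OF v]]) auto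
  then show ?case
    by (intro exI[of _ "\<lambda>s. (s - 1) * (\<Sum>j. (of_nat j + v) powr (- s))"]) (auto intro!: holomorphic_intros)
next
  case (Suc n)
  then obtain Y where Y: "Y holomorphic_on {s. Re s > 1 - real n}"
    and Y_eq: "\<And>s. Re s > 1 \<Longrightarrow> Y s = (s - 1) * (\<Sum>j. (of_nat j + v) powr (- s))"
    by blast
  define Y' where "Y' = (\<lambda>s. (\<Sum>j. powr_remainder (Suc n) (of_nat j + v) (s - 1)) + v powr (1 - s) -
           (\<Sum>i<n. ((1 - s) gchoose Suc i) / of_nat (i + 2) * Y (s + of_nat (Suc i))))"
  have "Y' s = (s - 1) * (\<Sum>j. (of_nat j + v) powr (- s))" if s: "Re s > 1" for s
    unfolding Y'_def using zeta_series_recurrence[OF v s, of n] s Y_eq by simp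
  moreover have "Y' holomorphic_on {s. Re s > 1 - real (Suc n)}"
    unfolding Y'_def
  proof (intro holomorphic_on_add holomorphic_on_diff holomorphic_on_sum holomorphic_on_mult holomorphic_on_divide)
    have "(\<lambda>s. \<Sum>j. 1 ^ j * powr_remainder (Suc n) (of_nat j + v) s) \<circ> (\<lambda>s. s - 1)
        holomorphic_on {s. Re s > 1 - real (Suc n)}"
      by (rule holomorphic_on_compose_gen[OF _ powr_remainder_series_holomorphic[OF v]])
         (auto intro!: holomorphic_intros)
    then show "(\<lambda>s. \<Sum>j. powr_remainder (Suc n) (of_nat j + v) (s - 1)) holomorphic_on {s. Re s > 1 - real (Suc n)}"
      by (simp add: o_def)
    have "v \<noteq> 0"
      using v by auto
    then show "(\<lambda>s. v powr (1 - s)) holomorphic_on {s. Re s > 1 - real (Suc n)}"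
      by (intro holomorphic_intros)
    show "(\<lambda>s. (1 - s) gchoose Suc i) holomorphic_on {s. Re s > 1 - real (Suc n)}" for i
      unfolding gbinomial_prod_rev by (intro holomorphic_intros) auto
    have "Y \<circ> (\<lambda>s. s + of_nat (Suc i)) holomorphic_on {s. Re s > 1 - real (Suc n)}" for i
      by (rule holomorphic_on_compose_gen[OF _ Y]) (auto intro!: holomorphic_intros)
    then show "(\<lambda>s. Y (s + of_nat (Suc i))) holomorphic_on {s. Re s > 1 - real (Suc n)}" for i
      by (simp add: o_def)
  qed (auto simp: add_eq_0_iff complex_eq_iff)
  ultimately show ?case
    by blast
qed

lemma glue_half_plane_continuations:
  fixes g :: "complex \<Rightarrow> complex"
  assumes "\<And>n::nat. \<exists>f. f holomorphic_on {s. Re s > 1 - real n} \<and> (\<forall>s. Re s > 1 \<longrightarrow> f s = g s)"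
  shows "\<exists>f. f holomorphic_on UNIV \<and> (\<forall>s. Re s > 1 \<longrightarrow> f s = g s)"
proof -
  obtain F where F: "\<And>n::nat. F n holomorphic_on {s. Re s > 1 - real n}"
    and Fg: "\<And>n s. Re s > 1 \<Longrightarrow> F n s = g s"
    using assms by metis
  have compat: "F n s = F m s" if "Re s > 1 - real n" "n \<le> m" for n m s
  proof (rule analytic_continuation_open[of "{s. Re s > 1}" "{s. Re s > 1 - real n}" "F n" "F m"])
    show "F m holomorphic_on {s. Re s > 1 - real n}"
      using F[of m] by (rule holomorphic_on_subset) (use that in auto)
    have "2 \<in> {s. Re s > 1}"
      by simp
    then show "{s. Re s > 1} \<noteq> {}"
      by blast
    show "open {s. Re s > 1}" "open {s. Re s > 1 - real n}"
      by (rule open_halfspace_Re_gt)+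
    show "connected {s. Re s > 1 - real n}"
      by (intro convex_connected convex_halfspace_Re_gt)
  qed (use that F Fg in auto)
  have compat': "F n s = F m s" if "Re s > 1 - real n" "Re s > 1 - real m" for n m s
    using compat that by (metis nat_le_linear)
  \<comment> \<open>any index whose half-plane contains \<open>s\<close> will do, since the functions are compatible\<close>
  define N where "N = (\<lambda>s. nat \<lceil>2 - Re s\<rceil>)"
  have N: "Re s > 1 - real (N s)" for s
    unfolding N_def by linarith
  define f where "f = (\<lambda>s. F (N s) s)"
  have "f field_differentiable at s" for s
  proof -
    have "F (N s) field_differentiable at s"
      by (rule holomorphic_on_imp_differentiable_at[OF F open_halfspace_Re_gt]) (use N in auto)
    then obtain D where "(F (N s) has_field_derivative D) (at s)"
      by (auto simp: field_differentiable_def)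
    then have "(f has_field_derivative D) (at s)"
    proof (rule has_field_derivative_transform_within_open[OF _ open_halfspace_Re_gt[of "1 - real (N s)"]])
      show "s \<in> {w. Re w > 1 - real (N s)}"
        using N by simp
      show "F (N s) w = f w" if "w \<in> {w. Re w > 1 - real (N s)}" for w
        unfolding f_def using that N[of w] by (intro compat') auto
    qed
    then show ?thesis
      by (auto simp: field_differentiable_def)
  qed
  then have "f holomorphic_on UNIV"
    by (simp add: holomorphic_on_def field_differentiable_at_within)
  moreover have "f s = g s" if "Re s > 1" for s
    using Fg that by (simp add: f_def)
  ultimately show ?thesis
    by blast
qed

lemma hurwitz_zeta_continuation_exists:
  "\<exists>f. f holomorphic_on - {1} \<and> (\<forall>s. Re s > 1 \<longrightarrow> (\<lambda>j. 1 / (of_nat j + v) powr s) sums f s)"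
proof -
  have "\<exists>f. f holomorphic_on - {1} \<and> (\<forall>s. Re s > 1 \<longrightarrow> (\<lambda>j. 1 / (of_nat j + v) powr s) sums f s)"
    if "Re v \<ge> 2 - real n" for n v
    using that
  proof (induction n arbitrary: v)
    case 0
    then have "Re v \<ge> 2" by simp
    from glue_half_plane_continuations[OF zeta_continuation_half_plane[OF this]]
    obtain Y where Y: "Y holomorphic_on UNIV"
      and Y_eq: "\<And>s. Re s > 1 \<Longrightarrow> Y s = (s - 1) * (\<Sum>j. (of_nat j + v) powr (- s))"
      by blast
    have "(\<lambda>j. 1 / (of_nat j + v) powr s) sums (Y s / (s - 1))" if "Re s > 1" for s
    proof -
      have "Y s / (s - 1) = (\<Sum>j. (of_nat j + v) powr (- s))"
        using Y_eq[OF that] that by auto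
      then show ?thesis
        using summable_sums[OF zeta_series_summable[OF that, of v]] by (simp add: powr_minus divide_inverse)
    qed
    moreover have "(\<lambda>s. Y s / (s - 1)) holomorphic_on - {1}"
      by (intro holomorphic_intros holomorphic_on_subset[OF Y]) auto
    ultimately show ?case
      by blast
  next
    case (Suc n)
    then have "Re (v + 1) \<ge> 2 - real n"
      by simp
    from Suc.IH[OF this] obtain f where f: "f holomorphic_on - {1}"
      and sums: "\<And>s. Re s > 1 \<Longrightarrow> (\<lambda>j. 1 / (of_nat j + (v + 1)) powr s) sums f s"
      by blast
    have "(\<lambda>j. 1 / (of_nat j + v) powr s) sums (f s + v powr (- s))" if "Re s > 1" for s
    proof -
      have "(\<lambda>j. 1 / (of_nat (Suc j) + v) powr s) sums f s"
        using sums[OF that] by (simp add: add_ac)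
      then show ?thesis
        by (subst (asm) sums_Suc_iff) (simp add: powr_minus divide_inverse)
    qed
    moreover have "(\<lambda>s. f s + v powr (- s)) holomorphic_on - {1}"
      by (intro holomorphic_on_add f powr_holomorphic_exponent)
    ultimately show ?case
      by blast
  qed
  moreover obtain n :: nat where "real n \<ge> 2 - Re v"
    using real_arch_simple by blast
  ultimately show ?thesis
    by (metis diff_le_eq add.commute)
qed

lemma
  shows hurwitz_zeta_holomorphic: "(\<lambda>s. hurwitz_zeta s v) holomorphic_on - {1}"
    and hurwitz_zeta_sums: "Re s > 1 \<Longrightarrow> (\<lambda>j. 1 / (of_nat j + v) powr s) sums hurwitz_zeta s v"
  using someI_ex[OF hurwitz_zeta_continuation_exists[of v]] unfolding hurwitz_zeta_def by auto

section \<open>The Lerch function at minus one\<close>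

text \<open>
  An absolutely summable power series is continuous on the closed disc; this identifies the analytic
  continuation at the boundary point \<open>- 1\<close> with the sum of the series there.
\<close>
lemma Abel_at_minus_one:
  fixes f :: "complex \<Rightarrow> complex"
  assumes c: "summable (\<lambda>j. norm (c j))"
    and f: "isCont f (- 1)"
    and sums: "\<And>z. norm z < 1 \<Longrightarrow> (\<lambda>j. z ^ (m + j) * c j) sums f z"
  shows "f (- 1) = (- 1) ^ m * (\<Sum>j. (- 1) ^ j * c j)"
proof -
  define g where "g = (\<lambda>z. \<Sum>j. z ^ j * c j)"
  have "uniform_limit (cball 0 1) (\<lambda>n z. \<Sum>j<n. z ^ j * c j) g sequentially"
    unfolding g_def
  proof (rule Weierstrass_m_test[OF _ c])
    show "norm (z ^ j * c j) \<le> norm (c j)" if "z \<in> cball 0 1" for j z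
      unfolding norm_mult norm_power using that by (intro mult_left_le_one_le power_le_one) auto
  qed
  then have "continuous_on (cball 0 1) g"
    by (rule uniform_limit_theorem[rotated]) (auto intro!: always_eventually continuous_intros)
  then have "(g \<longlongrightarrow> g (- 1)) (at (- 1) within cball 0 1)"
    by (auto simp: continuous_on_def)
  then have "(g \<longlongrightarrow> g (- 1)) (at (- 1) within ball 0 1)"
    by (rule tendsto_within_subset) auto
  then have "((\<lambda>z. z ^ m * g z) \<longlongrightarrow> (- 1) ^ m * g (- 1)) (at (- 1) within ball 0 1)"
    by (intro tendsto_intros)
  moreover have "eventually (\<lambda>z. z ^ m * g z = f z) (at (- 1) within ball 0 1)"
    unfolding eventually_at_filter
  proof (intro always_eventually allI impI)
    fix z :: complex assume "z \<in> ball 0 1"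
    then have z: "norm z < 1" by simp
    have "norm (z ^ j * c j) \<le> norm (c j)" for j
      unfolding norm_mult norm_power using z by (intro mult_left_le_one_le power_le_one) auto
    then have "summable (\<lambda>j. z ^ j * c j)"
      by (intro summable_comparison_test'[OF c])
    from sums_mult[OF summable_sums[OF this], of "z ^ m"]
    have "(\<lambda>j. z ^ (m + j) * c j) sums (z ^ m * g z)"
      by (simp add: g_def power_add mult.assoc)
    then show "z ^ m * g z = f z"
      using sums[OF z] by (rule sums_unique2)
  qed
  ultimately have "(f \<longlongrightarrow> (- 1) ^ m * g (- 1)) (at (- 1) within ball 0 1)"
    by (rule Lim_transform_eventually)
  moreover have "(f \<longlongrightarrow> f (- 1)) (at (- 1) within ball 0 1)"
    using f unfolding isCont_def by (rule tendsto_within_subset) auto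
  moreover have "at (- 1) within ball (0::complex) 1 \<noteq> bot"
    unfolding trivial_limit_within islimpt_ball by simp
  ultimately show ?thesis
    using tendsto_unique unfolding g_def by blast
qed

lemma isCont_lerch_branch: "z \<in> slit_plane \<Longrightarrow> isCont (lerch_branch s v) z"
  using holomorphic_on_imp_continuous_on[OF lerch_branch_holomorphic] open_slit_plane
  by (simp add: continuous_on_eq_continuous_at)

lemma lerch_branch_sums':
  "norm z < 1 \<Longrightarrow> (\<lambda>j. z ^ j * (of_nat j + v) powr (- s)) sums lerch_branch s v z"
  using lerch_branch_sums[of z v s] by (simp add: powr_minus divide_inverse)

lemma lerch_branch_at_minus_one_sums:
  assumes "Re s > 1"
  shows "lerch_branch s v (- 1) = (\<Sum>j. (- 1) ^ j * (of_nat j + v) powr (- s))"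
proof -
  have "lerch_branch s v (- 1) = (- 1) ^ 0 * (\<Sum>j. (- 1) ^ j * (of_nat j + v) powr (- s))"
  proof (rule Abel_at_minus_one[OF zeta_series_abs_summable[OF assms]])
    show "isCont (lerch_branch s v) (- 1)"
      by (rule isCont_lerch_branch) (auto simp: complex_eq_iff)
  qed (use lerch_branch_sums' in auto)
  then show ?thesis by simp
qed

text \<open>
  The analogue at \<open>z = - 1\<close> of the recurrence for the zeta function. For \<open>norm z < 1\<close>, summing the expansion
  of \<open>(x + 1) powr (- s)\<close> against \<open>z ^ j\<close> relates \<open>\<Phi>(z,s,v)\<close> to the functions \<open>\<Phi>(z,s + r,v)\<close>; then \<open>z\<close> tends to
  \<open>- 1\<close>. The term \<open>r = 0\<close> moves to the left and gives the factor \<open>1 - z = 2\<close>.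
\<close>
lemma lerch_branch_at_minus_one_recurrence:
  assumes v: "Re v \<ge> 2" and s: "Re s > - real n"
  shows "2 * lerch_branch s v (- 1) =
           v powr (- s) - (\<Sum>j. (- 1) ^ j * powr_remainder n (of_nat j + v) s) -
           (\<Sum>i<n. ((- s) gchoose Suc i) * lerch_branch (s + of_nat (Suc i)) v (- 1))"
proof -
  define f where "f = (\<lambda>z. lerch_branch s v z - v powr (- s) -
     z * (\<Sum>r\<le>n. ((- s) gchoose r) * lerch_branch (s + of_nat r) v z))"
  have "f (- 1) = (- 1) ^ 1 * (\<Sum>j. (- 1) ^ j * powr_remainder n (of_nat j + v) s)"
  proof (rule Abel_at_minus_one[OF powr_remainder_abs_summable[OF v s]])
    have "isCont (lerch_branch s v) (- 1)" for s
      by (rule isCont_lerch_branch) (auto simp: complex_eq_iff)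
    then show "isCont f (- 1)"
      unfolding f_def by (intro continuous_intros)
    fix z :: complex assume z: "norm z < 1"
    have "(\<lambda>j. z ^ Suc j * (of_nat (Suc j) + v) powr (- s)) sums (lerch_branch s v z - v powr (- s))"
      by (subst sums_Suc_iff) (use lerch_branch_sums'[OF z, of v s] in simp)
    moreover have "(\<lambda>j. z * (\<Sum>r\<le>n. ((- s) gchoose r) * (z ^ j * (of_nat j + v) powr (- (s + of_nat r))))) sums
        (z * (\<Sum>r\<le>n. ((- s) gchoose r) * lerch_branch (s + of_nat r) v z))"
      by (intro sums_mult sums_sum lerch_branch_sums' z)
    ultimately have "(\<lambda>j. z ^ Suc j * (of_nat (Suc j) + v) powr (- s) -
        z * (\<Sum>r\<le>n. ((- s) gchoose r) * (z ^ j * (of_nat j + v) powr (- (s + of_nat r))))) sums f z"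
      unfolding f_def by (rule sums_diff)
    moreover have "z ^ Suc j * (of_nat (Suc j) + v) powr (- s) -
        z * (\<Sum>r\<le>n. ((- s) gchoose r) * (z ^ j * (of_nat j + v) powr (- (s + of_nat r)))) =
        z ^ (1 + j) * powr_remainder n (of_nat j + v) s" for j
      by (simp add: powr_remainder_def algebra_simps sum_distrib_left)
    ultimately show "(\<lambda>j. z ^ (1 + j) * powr_remainder n (of_nat j + v) s) sums f z"
      by simp
  qed
  moreover have "(\<Sum>r\<le>n. ((- s) gchoose r) * lerch_branch (s + of_nat r) v (- 1)) =
      lerch_branch s v (- 1) + (\<Sum>i<n. ((- s) gchoose Suc i) * lerch_branch (s + of_nat (Suc i)) v (- 1))"
    by (subst sum.atMost_shift) simp
  ultimately show ?thesis
    unfolding f_def by (simp add: algebra_simps)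
qed

lemma lerch_branch_shift:
  "z \<in> slit_plane \<Longrightarrow> lerch_branch s v z = 1 / v powr s + z * lerch_branch s (v + 1) z"
  by (rule lerch_branch_eqI[OF lerch_continuation_shift[OF lerch_continuation_lerch_branch]])

text \<open>
  Holomorphy of \<open>\<Phi>(- 1,s,v)\<close> in \<open>s\<close> is not part of the definition, which continues in \<open>z\<close> for each
  fixed \<open>s\<close>. It is what allows the duplication formula at \<open>z = - 1\<close> to be continued in \<open>s\<close>.
\<close>
lemma lerch_branch_at_minus_one_entire: "(\<lambda>s. lerch_branch s v (- 1)) holomorphic_on UNIV"
proof -
  have right: "(\<lambda>s. lerch_branch s v (- 1)) holomorphic_on UNIV" if v: "Re v \<ge> 2" for v
  proof -
    have half_plane: "(\<lambda>s. lerch_branch s v (- 1)) holomorphic_on {s. Re s > - real n}" for n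
    proof (induction n)
      case 0
      have "(\<lambda>s. (v powr (- s) - (\<Sum>j. (- 1) ^ j * powr_remainder 0 (of_nat j + v) s)) / 2) holomorphic_on {s. Re s > - real 0}"
        by (intro holomorphic_intros holomorphic_on_powr_exponent powr_remainder_series_holomorphic v) auto
      then show ?case
      proof (rule holomorphic_transform)
        fix s assume "s \<in> {s. Re s > - real 0}"
        then show "(v powr (- s) - (\<Sum>j. (- 1) ^ j * powr_remainder 0 (of_nat j + v) s)) / 2 = lerch_branch s v (- 1)"
          using lerch_branch_at_minus_one_recurrence[OF v, of 0 s] by (simp add: mult.commute)
      qed
    next
      case (Suc n)
      have "(\<lambda>s. lerch_branch s v (- 1)) \<circ> (\<lambda>s. s + of_nat (Suc i)) holomorphic_on {s. Re s > - real (Suc n)}" for i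
        by (rule holomorphic_on_compose_gen[OF _ Suc.IH]) (auto intro!: holomorphic_intros)
      then have IH: "(\<lambda>s. lerch_branch (s + of_nat (Suc i)) v (- 1)) holomorphic_on {s. Re s > - real (Suc n)}" for i
        by (simp add: o_def)
      have "(\<lambda>s. (v powr (- s) - (\<Sum>j. (- 1) ^ j * powr_remainder (Suc n) (of_nat j + v) s) -
           (\<Sum>i<Suc n. ((- s) gchoose Suc i) * lerch_branch (s + of_nat (Suc i)) v (- 1))) / 2)
           holomorphic_on {s. Re s > - real (Suc n)}"
        unfolding gbinomial_prod_rev
        by (intro holomorphic_intros holomorphic_on_powr_exponent powr_remainder_series_holomorphic v IH) auto
      then show ?case
      proof (rule holomorphic_transform)
        fix s assume "s \<in> {s. Re s > - real (Suc n)}"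
        then have "Re s > - real (Suc n)" by simp
        from lerch_branch_at_minus_one_recurrence[OF v this]
        show "(v powr (- s) - (\<Sum>j. (- 1) ^ j * powr_remainder (Suc n) (of_nat j + v) s) -
           (\<Sum>i<Suc n. ((- s) gchoose Suc i) * lerch_branch (s + of_nat (Suc i)) v (- 1))) / 2 = lerch_branch s v (- 1)"
          by (simp add: mult.commute)
      qed
    qed
    have "(\<lambda>s. lerch_branch s v (- 1)) field_differentiable at s" for s
    proof -
      obtain n :: nat where "real n > - Re s"
        using reals_Archimedean2 by blast
      then show ?thesis
        by (intro holomorphic_on_imp_differentiable_at[OF half_plane[of n] open_halfspace_Re_gt]) simp
    qed
    then show ?thesis
      by (simp add: holomorphic_on_def field_differentiable_at_within)
  qed
  have "(\<lambda>s. lerch_branch s v (- 1)) holomorphic_on UNIV" if "Re v \<ge> 2 - real n" for n v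
    using that
  proof (induction n arbitrary: v)
    case 0
    then show ?case by (intro right) simp
  next
    case (Suc n)
    have "(\<lambda>s. v powr (- s) - lerch_branch s (v + 1) (- 1)) holomorphic_on UNIV"
      using Suc.prems by (intro holomorphic_on_diff Suc.IH holomorphic_on_powr_exponent holomorphic_intros) simp
    moreover have "v powr (- s) - lerch_branch s (v + 1) (- 1) = lerch_branch s v (- 1)" for s
      by (subst lerch_branch_shift[of "- 1" s v]) (auto simp: complex_eq_iff powr_minus divide_inverse)
    ultimately show ?case
      by simp
  qed
  moreover obtain n :: nat where "real n \<ge> 2 - Re v"
    using real_arch_simple by blast
  ultimately show ?thesis
    by (metis diff_le_eq add.commute)
qed

section \<open>The duplication formula\<close>

lemma sums_even_add_odd:
  fixes c :: "nat \<Rightarrow> 'a :: real_normed_vector"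
  assumes "c sums S" "(\<lambda>j. c (2 * j)) sums A" "(\<lambda>j. c (Suc (2 * j))) sums B"
  shows "A + B = S"
proof -
  have "{j * 2..<j * 2 + 2} = {2 * j, Suc (2 * j)}" for j :: nat
    by auto
  then have "(\<lambda>j. c (2 * j) + c (Suc (2 * j))) sums S"
    using sums_group[OF assms(1), of 2] by simp
  then show ?thesis
    using sums_add[OF assms(2,3)] sums_unique2 by blast
qed

lemma
  fixes s v :: complex
  shows even_term_powr: "(of_nat (2 * j) + v) powr s = 2 powr s * (of_nat j + v / 2) powr s"
    and odd_term_powr: "(of_nat (Suc (2 * j)) + v) powr s = 2 powr s * (of_nat j + (v + 1) / 2) powr s"
proof -
  have "(2 * x) powr s = 2 powr s * x powr s" for x :: complex
    by (rule powr_times_real_left) auto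
  from this[of "of_nat j + v / 2"] this[of "of_nat j + (v + 1) / 2"]
  show "(of_nat (2 * j) + v) powr s = 2 powr s * (of_nat j + v / 2) powr s"
    "(of_nat (Suc (2 * j)) + v) powr s = 2 powr s * (of_nat j + (v + 1) / 2) powr s"
    by (simp_all add: algebra_simps add_divide_distrib)
qed

lemma lerch_branch_duplication_disc:
  assumes w: "norm w < 1"
  shows "lerch_branch s (v / 2) (w\<^sup>2) + w * lerch_branch s ((v + 1) / 2) (w\<^sup>2) = 2 powr s * lerch_branch s v w"
proof -
  have w2: "norm (w\<^sup>2) < 1"
    using w by (simp add: norm_power power_less_one_iff)
  have "lerch_branch s (v / 2) (w\<^sup>2) / 2 powr s + w * lerch_branch s ((v + 1) / 2) (w\<^sup>2) / 2 powr s = lerch_branch s v w"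
  proof (rule sums_even_add_odd[OF lerch_branch_sums[OF w]])
    show "(\<lambda>j. w ^ (2 * j) / (of_nat (2 * j) + v) powr s) sums (lerch_branch s (v / 2) (w\<^sup>2) / 2 powr s)"
      using sums_divide[OF lerch_branch_sums[OF w2, of "v / 2" s], of "2 powr s"]
      unfolding even_term_powr by (simp add: power_mult mult.commute[of _ "2 powr s"])
    show "(\<lambda>j. w ^ Suc (2 * j) / (of_nat (Suc (2 * j)) + v) powr s) sums (w * lerch_branch s ((v + 1) / 2) (w\<^sup>2) / 2 powr s)"
      using sums_divide[OF sums_mult[OF lerch_branch_sums[OF w2, of "(v + 1) / 2" s], of w], of "2 powr s"]
      unfolding odd_term_powr by (simp add: power_mult mult.commute[of _ "2 powr s"])
  qed
  then show ?thesis
    by (simp add: field_simps)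
qed

text \<open>
  Both sides are holomorphic in \<open>w\<close> on the plane slit along \<open>(-\<infinity>,- 1]\<close> and \<open>[1,\<infinity>)\<close>, which is star-shaped
  about \<open>0\<close>.
\<close>
lemma lerch_branch_duplication:
  assumes w: "w\<^sup>2 \<in> slit_plane"
  shows "lerch_branch s (v / 2) (w\<^sup>2) + w * lerch_branch s ((v + 1) / 2) (w\<^sup>2) = 2 powr s * lerch_branch s v w"
proof -
  define D where "D = {w. w\<^sup>2 \<in> slit_plane}"
  have D_slit: "D \<subseteq> slit_plane"
  proof
    fix w assume "w \<in> D"
    show "w \<in> slit_plane"
    proof
      assume "w \<in> complex_of_real ` {1..}"
      then obtain x where "x \<ge> 1" "w = of_real x" by auto
      then have "w\<^sup>2 = of_real (x\<^sup>2)" "x\<^sup>2 \<ge> 1"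
        by auto
      then show False
        using \<open>w \<in> D\<close> unfolding D_def by (metis ComplD atLeast_iff imageI mem_Collect_eq)
    qed
  qed
  have "open D"
  proof -
    have "open ((\<lambda>w. w\<^sup>2) -` slit_plane)"
      by (intro open_vimage open_slit_plane continuous_intros)
    then show ?thesis
      by (simp add: D_def vimage_def)
  qed
  have "connected D"
  proof (rule starlike_imp_connected)
    have "closed_segment 0 w \<subseteq> D" if "w \<in> D" for w
    proof
      fix z assume "z \<in> closed_segment 0 w"
      then obtain t where t: "0 \<le> t" "t \<le> 1" "z = of_real t * w"
        by (auto simp: closed_segment_def scaleR_conv_of_real)
      then have "z\<^sup>2 = of_real (t\<^sup>2) * w\<^sup>2" "0 \<le> t\<^sup>2" "t\<^sup>2 \<le> 1"
        by (auto simp: power_mult_distrib power_le_one)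
      then show "z \<in> D"
        using of_real_mult_in_slit_plane[of "w\<^sup>2" "t\<^sup>2"] that by (simp add: D_def)
    qed
    moreover have "0 \<in> D"
      by (auto simp: D_def)
    ultimately show "starlike D"
      unfolding starlike_def by blast
  qed
  have comp: "(\<lambda>w. lerch_branch s v (w\<^sup>2)) holomorphic_on D" for v
  proof -
    have "lerch_branch s v \<circ> (\<lambda>w. w\<^sup>2) holomorphic_on D"
      by (rule holomorphic_on_compose_gen[OF _ lerch_branch_holomorphic])
         (auto simp: D_def intro!: holomorphic_intros)
    then show ?thesis
      by (simp add: o_def)
  qed
  show ?thesis
  proof (rule analytic_continuation_open[of "ball 0 1" D
      "\<lambda>w. lerch_branch s (v / 2) (w\<^sup>2) + w * lerch_branch s ((v + 1) / 2) (w\<^sup>2)"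
      "\<lambda>w. 2 powr s * lerch_branch s v w"])
    show "(\<lambda>w. lerch_branch s (v / 2) (w\<^sup>2) + w * lerch_branch s ((v + 1) / 2) (w\<^sup>2)) holomorphic_on D"
      by (intro holomorphic_intros comp)
    show "(\<lambda>w. 2 powr s * lerch_branch s v w) holomorphic_on D"
      by (intro holomorphic_intros holomorphic_on_subset[OF lerch_branch_holomorphic D_slit])
    show "ball 0 1 \<subseteq> D"
    proof
      fix w :: complex assume "w \<in> ball 0 1"
      then have "norm (w\<^sup>2) < 1"
        by (simp add: norm_power power_less_one_iff)
      then show "w \<in> D"
        unfolding D_def using unit_disc_subset_slit_plane by blast
    qed
    show "lerch_branch s (v / 2) (w\<^sup>2) + w * lerch_branch s ((v + 1) / 2) (w\<^sup>2) = 2 powr s * lerch_branch s v w"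
      if "w \<in> ball 0 1" for w
      using that by (intro lerch_branch_duplication_disc) simp
  qed (use w \<open>open D\<close> \<open>connected D\<close> in \<open>auto simp: D_def\<close>)
qed

text \<open>
  The duplication formula at \<open>w = 1\<close> and \<open>w = - 1\<close>, where \<open>w\<^sup>2 = 1\<close> and the continuation is in \<open>s\<close> instead.
\<close>
lemma hurwitz_zeta_duplication:
  assumes "s \<noteq> 1"
  shows "hurwitz_zeta s (v / 2) + hurwitz_zeta s ((v + 1) / 2) = 2 powr s * hurwitz_zeta s v"
    and "hurwitz_zeta s (v / 2) - hurwitz_zeta s ((v + 1) / 2) = 2 powr s * lerch_branch s v (- 1)"
proof -
  have continue: "f s = g s"
    if "f holomorphic_on - {1}" "g holomorphic_on - {1}" "\<And>s. Re s > 1 \<Longrightarrow> f s = g s"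
    for f g :: "complex \<Rightarrow> complex"
  proof (rule analytic_continuation_open[of "{s. Re s > 1}" "- {1}" f g])
    have "2 \<in> {s. Re s > 1}"
      by simp
    then show "{s. Re s > 1} \<noteq> {}"
      by blast
    show "open {s. Re s > 1}"
      by (rule open_halfspace_Re_gt)
    show "connected (- {1 :: complex})"
      by (rule connected_punctured_universe) simp
  qed (use that assms in auto)
  have half: "(\<lambda>j. 1 / (of_nat (2 * j) + v) powr s) sums (hurwitz_zeta s (v / 2) / 2 powr s)"
      "(\<lambda>j. 1 / (of_nat (Suc (2 * j)) + v) powr s) sums (hurwitz_zeta s ((v + 1) / 2) / 2 powr s)"
    if "Re s > 1" for s
    using sums_divide[OF hurwitz_zeta_sums[OF that, of "v / 2"], of "2 powr s"]
      sums_divide[OF hurwitz_zeta_sums[OF that, of "(v + 1) / 2"], of "2 powr s"]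
    unfolding even_term_powr odd_term_powr by (simp_all add: mult.commute)
  show "hurwitz_zeta s (v / 2) + hurwitz_zeta s ((v + 1) / 2) = 2 powr s * hurwitz_zeta s v"
  proof (rule continue[of "\<lambda>s. hurwitz_zeta s (v / 2) + hurwitz_zeta s ((v + 1) / 2)" "\<lambda>s. 2 powr s * hurwitz_zeta s v"])
    fix s :: complex assume s: "Re s > 1"
    from sums_even_add_odd[OF hurwitz_zeta_sums[OF s, of v] half[OF s]]
    show "hurwitz_zeta s (v / 2) + hurwitz_zeta s ((v + 1) / 2) = 2 powr s * hurwitz_zeta s v"
      by (simp add: field_simps)
  qed (intro holomorphic_intros hurwitz_zeta_holomorphic; simp)+
  show "hurwitz_zeta s (v / 2) - hurwitz_zeta s ((v + 1) / 2) = 2 powr s * lerch_branch s v (- 1)"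
  proof (rule continue[of "\<lambda>s. hurwitz_zeta s (v / 2) - hurwitz_zeta s ((v + 1) / 2)" "\<lambda>s. 2 powr s * lerch_branch s v (- 1)"])
    show "(\<lambda>s. 2 powr s * lerch_branch s v (- 1)) holomorphic_on - {1}"
      by (intro holomorphic_intros holomorphic_on_subset[OF lerch_branch_at_minus_one_entire]) auto
    \<comment> \<open>the alternating series subtracts the odd terms instead of adding them\<close>
    fix s :: complex assume s: "Re s > 1"
    have "norm ((- 1) ^ j * (of_nat j + v) powr (- s)) = norm ((of_nat j + v) powr (- s))" for j
      by (simp add: norm_mult norm_power)
    then have "summable (\<lambda>j. (- 1) ^ j * (of_nat j + v) powr (- s))"
      using zeta_series_abs_summable[OF s, of v] by (intro summable_norm_cancel[of "\<lambda>j. (- 1) ^ j * (of_nat j + v) powr (- s)"]) simp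
    then have "(\<lambda>j. (- 1) ^ j * (1 / (of_nat j + v) powr s)) sums lerch_branch s v (- 1)"
      unfolding lerch_branch_at_minus_one_sums[OF s] by (simp add: sums_iff powr_minus divide_inverse)
    from sums_even_add_odd[OF this, of "hurwitz_zeta s (v / 2) / 2 powr s" "- (hurwitz_zeta s ((v + 1) / 2) / 2 powr s)"]
    have "hurwitz_zeta s (v / 2) / 2 powr s + - (hurwitz_zeta s ((v + 1) / 2) / 2 powr s) = lerch_branch s v (- 1)"
      using half(1)[OF s] sums_minus[OF half(2)[OF s]] by simp
    then show "hurwitz_zeta s (v / 2) - hurwitz_zeta s ((v + 1) / 2) = 2 powr s * lerch_branch s v (- 1)"
      by (simp add: field_simps)
  qed (intro holomorphic_intros hurwitz_zeta_holomorphic; simp)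
qed

lemma hurwitz_lerch_slit_plane: "z \<in> slit_plane \<Longrightarrow> hurwitz_lerch z s v = lerch_branch s v z"
  by (auto simp: hurwitz_lerch_def)

text \<open>
  If \<open>w\<^sup>2\<close> lies on the open cut, \<open>w = x\<close> is real. Points below \<open>x\<^sup>2\<close> have their square roots below \<open>x\<close> if
  \<open>x > 0\<close> and above \<open>x\<close> if \<open>x < 0\<close>, since \<open>Im (w\<^sup>2) = 2 Re w Im w\<close>. So the approach of \<open>w\<^sup>2\<close> to the cut from below
  is the approach of \<open>w\<close> to \<open>x\<close> on the side where \<open>x Im w < 0\<close>; for \<open>x > 1\<close> this is again the lower side.
\<close>
lemma hurwitz_lerch_duplication_cut:
  fixes x :: real
  assumes x: "\<bar>x\<bar> > 1"
  defines "F \<equiv> at (complex_of_real x) within {w. x * Im w < 0}"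
  assumes lim: "(lerch_branch s v \<longlongrightarrow> hurwitz_lerch (of_real x) s v) F"
  shows "hurwitz_lerch ((of_real x)\<^sup>2) s (v / 2) + of_real x * hurwitz_lerch ((of_real x)\<^sup>2) s ((v + 1) / 2) =
           2 powr s * hurwitz_lerch (of_real x) s v"
proof -
  have F: "F \<noteq> bot"
    unfolding F_def trivial_limit_within islimpt_approachable not_not
  proof (intro allI impI)
    fix d :: real assume "d > 0"
    then show "\<exists>y\<in>{w. x * Im w < 0}. y \<noteq> complex_of_real x \<and> dist y (complex_of_real x) < d"
      using x by (intro bexI[of _ "Complex x (- sgn x * d / 2)"])
         (auto simp: dist_norm complex_eq_iff cmod_def sgn_if mult_less_0_iff)
  qed
  have ident: "((\<lambda>w. w) \<longlongrightarrow> of_real x) F"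
    unfolding F_def by (rule tendsto_ident_at)
  have "((\<lambda>w. x * Re w) \<longlongrightarrow> x * Re (of_real x)) F"
    by (intro tendsto_intros ident)
  then have "eventually (\<lambda>w. x * Re w > 0) F"
    by (rule order_tendstoD) (use x in \<open>auto simp: zero_less_mult_iff\<close>)
  moreover have "eventually (\<lambda>w. x * Im w < 0) F"
    by (simp add: F_def eventually_at_filter)
  ultimately have below: "eventually (\<lambda>w. Im (w\<^sup>2) < 0) F"
  proof eventually_elim
    case (elim w)
    have "x\<^sup>2 * Im (w\<^sup>2) = 2 * ((x * Re w) * (x * Im w))"
      by (simp add: power2_eq_square)
    also have "\<dots> < 0"
      using mult_pos_neg[OF elim] by (simp add: mult_ac)
    finally show ?case
      using zero_le_power2[of x] by (auto simp: mult_less_0_iff)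
  qed
  have x2: "x\<^sup>2 > 1"
    using x one_less_power[of "\<bar>x\<bar>" 2] by simp
  have square: "filterlim (\<lambda>w. w\<^sup>2) (at (of_real (x\<^sup>2)) within {w. Im w < 0}) F"
    unfolding filterlim_at
  proof
    show "eventually (\<lambda>w. w\<^sup>2 \<in> {w. Im w < 0} \<and> w\<^sup>2 \<noteq> complex_of_real (x\<^sup>2)) F"
      using below by eventually_elim auto
    show "((\<lambda>w. w\<^sup>2) \<longlongrightarrow> complex_of_real (x\<^sup>2)) F"
      unfolding of_real_power by (intro tendsto_intros ident)
  qed
  have lim_square: "((\<lambda>w. lerch_branch s u (w\<^sup>2)) \<longlongrightarrow> hurwitz_lerch ((of_real x)\<^sup>2) s u) F" for u
    using filterlim_compose[OF lerch_branch_tendsto_from_below[OF x2] square] by simp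
  have "((\<lambda>w. lerch_branch s (v / 2) (w\<^sup>2) + w * lerch_branch s ((v + 1) / 2) (w\<^sup>2)) \<longlongrightarrow>
      hurwitz_lerch ((of_real x)\<^sup>2) s (v / 2) + of_real x * hurwitz_lerch ((of_real x)\<^sup>2) s ((v + 1) / 2)) F"
    by (intro tendsto_intros lim_square ident)
  moreover have "eventually (\<lambda>w. lerch_branch s (v / 2) (w\<^sup>2) + w * lerch_branch s ((v + 1) / 2) (w\<^sup>2) =
      2 powr s * lerch_branch s v w) F"
    using below by eventually_elim (intro lerch_branch_duplication Im_nonzero_in_slit_plane, simp)
  ultimately have "((\<lambda>w. 2 powr s * lerch_branch s v w) \<longlongrightarrow>
      hurwitz_lerch ((of_real x)\<^sup>2) s (v / 2) + of_real x * hurwitz_lerch ((of_real x)\<^sup>2) s ((v + 1) / 2)) F"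
    by (rule Lim_transform_eventually)
  moreover have "((\<lambda>w. 2 powr s * lerch_branch s v w) \<longlongrightarrow> 2 powr s * hurwitz_lerch (of_real x) s v) F"
    by (intro tendsto_intros lim)
  ultimately show ?thesis
    using tendsto_unique[OF F] by blast
qed

theorem hurwitz_lerch_duplication:
  assumes "\<not> (w\<^sup>2 = 1 \<and> s = 1)"
  shows "hurwitz_lerch (w\<^sup>2) s (v / 2) + w * hurwitz_lerch (w\<^sup>2) s ((v + 1) / 2) = 2 powr s * hurwitz_lerch w s v"
proof (cases "w\<^sup>2 \<in> slit_plane")
  case True
  moreover have "w \<in> slit_plane"
  proof
    assume "w \<in> complex_of_real ` {1..}"
    then obtain x where "x \<ge> 1" "w = of_real x" by auto
    then have "w\<^sup>2 = of_real (x\<^sup>2)" "x\<^sup>2 \<ge> 1"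
      by auto
    then show False
      using True by (metis ComplD atLeast_iff imageI)
  qed
  ultimately show ?thesis
    using lerch_branch_duplication[OF True] by (simp only: hurwitz_lerch_slit_plane)
next
  case False
  then obtain y where y: "y \<ge> 1" "w\<^sup>2 = of_real y"
    by auto
  then have "w\<^sup>2 = (of_real (sqrt y))\<^sup>2"
    by (simp flip: of_real_power)
  then have "w = of_real (sqrt y) \<or> w = of_real (- sqrt y)"
    by (auto simp: power2_eq_iff)
  then obtain x where wx: "w = complex_of_real x"
    by blast
  then have "x\<^sup>2 = y"
    using y by (metis of_real_eq_iff of_real_power)
  then have "\<bar>x\<bar> \<ge> 1"
    using y abs_square_less_1[of x] by linarith
  then consider "x = 1" | "x = - 1" | "x > 1" | "x < - 1"
    by linarith
  then show ?thesis
  proof cases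
    case 1
    then show ?thesis
      using assms hurwitz_zeta_duplication(1)[of s v] by (simp add: wx hurwitz_lerch_def)
  next
    case 2
    have "hurwitz_lerch (- 1) s v = lerch_branch s v (- 1)"
      by (rule hurwitz_lerch_slit_plane) (auto simp: complex_eq_iff)
    then show ?thesis
      using 2 assms hurwitz_zeta_duplication(2)[of s v] by (simp add: wx hurwitz_lerch_def)
  next
    case 3
    then have "{w. x * Im w < 0} = {w. Im w < 0}"
      by (auto simp: mult_less_0_iff)
    then show ?thesis
      unfolding wx using 3 lerch_branch_tendsto_from_below[OF 3, of s v]
      by (intro hurwitz_lerch_duplication_cut) auto
  next
    case 4
    then have slit: "complex_of_real x \<in> slit_plane"
      by auto
    have "(lerch_branch s v \<longlongrightarrow> lerch_branch s v (of_real x)) (at (of_real x) within {w. x * Im w < 0})"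
      using isCont_lerch_branch[OF slit, of s v] unfolding isCont_def by (rule tendsto_within_subset) auto
    then show ?thesis
      unfolding wx using 4 hurwitz_lerch_slit_plane[OF slit]
      by (intro hurwitz_lerch_duplication_cut) auto
  qed
qed

section \<open>The telescoping sum\<close>

theorem theorem4p153:
  fixes n :: nat and k m a :: complex
  assumes "n > 0" and "a \<noteq> 0"
    and "\<And>p. p \<in> {1..n} \<Longrightarrow>
      hurwitz_lerch_defined (exp (\<i> * 2 powi (1 - int p) * m)) (-k)
        (1/4 - \<i> * 2 powi (-1 + int p) * Ln a)"
    and "\<And>p. p \<in> {1..n} \<Longrightarrow>
      hurwitz_lerch_defined (exp (\<i> * 2 powi (1 - int p) * m)) (-k)
        (3/4 - \<i> * 2 powi (-1 + int p) * Ln a)"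
    and "\<And>p. p \<in> {1..n} \<Longrightarrow>
      hurwitz_lerch_defined (exp (\<i> * 2 powi (1 - int p) * m)) (-k)
        (1/2 * (1 - \<i> * 2 ^ p * Ln a))"
    and "hurwitz_lerch_defined (exp (\<i> * m)) (-k) (1/2 - \<i> * Ln a)"
    and "hurwitz_lerch_defined (exp (\<i> * 2 powi (- int n) * m)) (-k) (1/2 - \<i> * 2 ^ n * Ln a)"
  shows
    "(\<Sum>p = 1..n.
        2 powr k * (\<i> * 2 powi (- int p)) powr (1 + k) * exp (\<i> * 2 powi (-1 - int p) * m) *
        (hurwitz_lerch (exp (\<i> * 2 powi (1 - int p) * m)) (-k)
           (1/4 - \<i> * 2 powi (-1 + int p) * Ln a)
         + exp (\<i> * 2 powi (- int p) * m) *
           hurwitz_lerch (exp (\<i> * 2 powi (1 - int p) * m)) (-k)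
             (3/4 - \<i> * 2 powi (-1 + int p) * Ln a)
         - 2 * exp (\<i> * 2 powi (-1 - int p) * m) *
           hurwitz_lerch (exp (\<i> * 2 powi (1 - int p) * m)) (-k)
             (1/2 * (1 - \<i> * 2 ^ p * Ln a))))
     = - \<i> * 2 powi (- int n) *
        (2 ^ n * exp (1/2 * \<i> * (m + k * of_real pi)) *
           hurwitz_lerch (exp (\<i> * m)) (-k) (1/2 - \<i> * Ln a)
         - (\<i> * 2 powi (- int n)) powr k * exp (\<i> * 2 powi (-1 - int n) * m) *
           hurwitz_lerch (exp (\<i> * 2 powi (- int n) * m)) (-k) (1/2 - \<i> * 2 ^ n * Ln a))"
proof -
  define w where "w = (\<lambda>p::nat. exp (\<i> * 2 powi (- int p) * m))"
  define u where "u = (\<lambda>p::nat. 1 / 2 - \<i> * 2 ^ p * Ln a)"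
  define A where "A = (\<lambda>p::nat. (\<i> * 2 powi (- int p)) powr (1 + k) * exp (\<i> * 2 powi (-1 - int p) * m) *
      hurwitz_lerch (w p) (-k) (u p))"
  define T where "T = (\<lambda>p::nat.
        2 powr k * (\<i> * 2 powi (- int p)) powr (1 + k) * exp (\<i> * 2 powi (-1 - int p) * m) *
        (hurwitz_lerch (exp (\<i> * 2 powi (1 - int p) * m)) (-k)
           (1/4 - \<i> * 2 powi (-1 + int p) * Ln a)
         + exp (\<i> * 2 powi (- int p) * m) *
           hurwitz_lerch (exp (\<i> * 2 powi (1 - int p) * m)) (-k)
             (3/4 - \<i> * 2 powi (-1 + int p) * Ln a)
         - 2 * exp (\<i> * 2 powi (-1 - int p) * m) *
           hurwitz_lerch (exp (\<i> * 2 powi (1 - int p) * m)) (-k)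
             (1/2 * (1 - \<i> * 2 ^ p * Ln a))))"
  have step: "T (Suc q) = A (Suc q) - A q" if q: "Suc q \<le> n" for q
  proof -
    define e where "e = exp (\<i> * 2 powi (-1 - int (Suc q)) * m)"
    define P where "P = (\<i> * 2 powi (- int (Suc q))) powr (1 + k)"
    have "2 powi (1 - int (Suc q)) = (2 * 2 powi (- int (Suc q)) :: complex)"
      by (simp add: power_int_diff power_int_minus inverse_eq_divide)
    then have w_sq: "exp (\<i> * 2 powi (1 - int (Suc q)) * m) = (w (Suc q))\<^sup>2" and w_q: "w q = (w (Suc q))\<^sup>2"
      by (simp_all add: w_def mult_ac flip: exp_double)
    have "2 powi (- int (Suc q)) = (2 * 2 powi (-1 - int (Suc q)) :: complex)"
      by (simp add: power_int_diff power_int_minus)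
    then have e_sq: "w (Suc q) = e\<^sup>2"
      by (simp add: w_def e_def mult_ac flip: exp_double)
    have e_q: "exp (\<i> * 2 powi (-1 - int q) * m) = e\<^sup>2"
      using e_sq by (simp add: w_def)
    have u_halves: "1/4 - \<i> * 2 powi (-1 + int (Suc q)) * Ln a = u (Suc q) / 2"
        "3/4 - \<i> * 2 powi (-1 + int (Suc q)) * Ln a = (u (Suc q) + 1) / 2"
        "1/2 * (1 - \<i> * 2 ^ Suc q * Ln a) = u q"
      by (simp_all add: u_def field_simps)
    have "\<not> ((w (Suc q))\<^sup>2 = 1 \<and> -k = 1)"
      using assms(3)[of "Suc q"] q unfolding w_sq hurwitz_lerch_defined_def by auto
    from hurwitz_lerch_duplication[OF this, of "u (Suc q)"]
    have dup: "hurwitz_lerch ((w (Suc q))\<^sup>2) (-k) (u (Suc q) / 2) +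
        w (Suc q) * hurwitz_lerch ((w (Suc q))\<^sup>2) (-k) ((u (Suc q) + 1) / 2) =
        2 powr (-k) * hurwitz_lerch (w (Suc q)) (-k) (u (Suc q))" .
    \<comment> \<open>extracting the positive factor \<open>2\<close> does not change the branch of the power\<close>
    have "(2 * (\<i> * 2 powi (- int (Suc q)))) powr (1 + k) = 2 powr (1 + k) * P"
      unfolding P_def by (rule powr_times_real_left) auto
    moreover have "2 * (\<i> * 2 powi (- int (Suc q))) = \<i> * 2 powi (- int q)"
      by (simp add: power_int_diff power_int_minus inverse_eq_divide)
    moreover have "(2 :: complex) powr (1 + k) = 2 * 2 powr k"
      by (simp add: powr_add)
    ultimately have P_q: "(\<i> * 2 powi (- int q)) powr (1 + k) = 2 * 2 powr k * P"
      by (simp only:)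
    have "T (Suc q) = 2 powr k * P * e * ((hurwitz_lerch ((w (Suc q))\<^sup>2) (-k) (u (Suc q) / 2) +
        w (Suc q) * hurwitz_lerch ((w (Suc q))\<^sup>2) (-k) ((u (Suc q) + 1) / 2))
        - 2 * e * hurwitz_lerch ((w (Suc q))\<^sup>2) (-k) (u q))"
      unfolding T_def w_sq u_halves by (simp only: P_def e_def w_def)
    also have "\<dots> = (2 powr k * 2 powr (-k)) * (P * e * hurwitz_lerch (w (Suc q)) (-k) (u (Suc q)))
        - 2 * 2 powr k * P * e\<^sup>2 * hurwitz_lerch (w q) (-k) (u q)"
      unfolding dup w_q by (simp add: algebra_simps power2_eq_square)
    also have "2 powr k * 2 powr (-k) = (1 :: complex)"
      by (simp add: powr_minus)
    also have "1 * (P * e * hurwitz_lerch (w (Suc q)) (-k) (u (Suc q))) - 2 * 2 powr k * P * e\<^sup>2 * hurwitz_lerch (w q) (-k) (u q)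
        = A (Suc q) - A q"
      unfolding A_def P_q e_q by (simp add: P_def e_def)
    finally show ?thesis .
  qed
  have "(\<Sum>p = 1..n. T p) = (\<Sum>q<n. T (Suc q))"
    by (rule sum.reindex_bij_witness[of _ Suc "\<lambda>p. p - 1"]) auto
  also have "\<dots> = (\<Sum>q<n. A (Suc q) - A q)"
    using step by (intro sum.cong) auto
  also have "\<dots> = A n - A 0"
    by (rule sum_lessThan_telescope)
  \<comment> \<open>here \<open>\<i> powr k = exp (k \<i> \<pi> / 2)\<close> is the principal power\<close>
  also have "A 0 = \<i> * exp (1/2 * \<i> * (m + k * of_real pi)) * hurwitz_lerch (exp (\<i> * m)) (-k) (1/2 - \<i> * Ln a)"
  proof -
    have "\<i> powr (1 + k) = \<i> * exp (1/2 * \<i> * (k * of_real pi))"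
    proof -
      have "\<i> powr (1 + k) = \<i> * \<i> powr k"
        by (subst powr_add) simp
      also have "\<i> powr k = exp (1/2 * \<i> * (k * of_real pi))"
        by (simp add: powr_def mult_ac)
      finally show ?thesis .
    qed
    then show ?thesis
      by (simp add: A_def w_def u_def power_int_minus ring_distribs exp_add mult_ac)
  qed
  also have "A n = \<i> * 2 powi (- int n) * ((\<i> * 2 powi (- int n)) powr k * exp (\<i> * 2 powi (-1 - int n) * m) *
      hurwitz_lerch (exp (\<i> * 2 powi (- int n) * m)) (-k) (1/2 - \<i> * 2 ^ n * Ln a))"
    by (simp add: A_def w_def u_def powr_add mult_ac)
  finally have "(\<Sum>p = 1..n. T p) = \<i> * 2 powi (- int n) * ((\<i> * 2 powi (- int n)) powr k *
      exp (\<i> * 2 powi (-1 - int n) * m) *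
      hurwitz_lerch (exp (\<i> * 2 powi (- int n) * m)) (-k) (1/2 - \<i> * 2 ^ n * Ln a)) -
      \<i> * exp (1/2 * \<i> * (m + k * of_real pi)) * hurwitz_lerch (exp (\<i> * m)) (-k) (1/2 - \<i> * Ln a)" .
  moreover have "\<i> * c * X - \<i> * E * H = - \<i> * c * (d * E * H - X)" if "c * d = 1" for c d E H X :: complex
    using that by algebra
  moreover have "2 powi (- int n) * 2 ^ n = (1 :: complex)"
    by (simp add: power_int_minus)
  ultimately show ?thesis
    unfolding T_def by (simp only:)
qed

end
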